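(* Let $\alpha_1,\alpha_2>-1$ and $\alpha>-\min(1,1+\alpha_1,1+\alpha_2)$. For the Jacobi $\beta$-ensemble with $\beta=2\alpha/N$, let $m^{\rm J}_{p,0}$, $m^{\rm J}_{p,1}$ be the leading and first-correction moments and $\tilde\mu^{\rm J}_{p,0}$ the summed leading covariances (see context). Then, with $m^{\rm J}_{0,1}=0$, for all integers $p\ge1$, $$m_{p,1}^{\rm J}=\frac{1}{p+1+\alpha_1+\alpha_2+2\alpha}\Big(\alpha(p+1)\,m_{p,0}^{\rm J}-\alpha(\tilde\mu_{p,0}^{\rm J}+1)-2\alpha\sum_{s=1}^{p-1}m_{s,1}^{\rm J}\,m_{p-s,0}^{\rm J}-\alpha_2\sum_{s=1}^{p-1}m_{s,1}^{\rm J}\Big),$$ where $\{\tilde\mu^{\rm J}_{p,0}\}_{p\ge1}$ satisfies $$\Big(\alpha_1+\alpha_2+2\alpha+1+\frac p2\Big)\tilde\mu_{p,0}^{\rm J}=\sum_{s=1}^{p-1}s\,m_{s,0}^{\rm J}-\frac{(p-1)p}2\,m_{p,0}^{\rm J}-\alpha_2\sum_{s=1}^{p-1}\tilde\mu_{s,0}^{\rm J}-2\alpha\sum_{s=1}^{p-1}\tilde\mu_{s,0}^{\rm J}\,m_{p-s,0}^{\rm J}.$$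
   Context: The Jacobi $\beta$-ensemble is the probability density on $(0,1)^N$ proportional to $\prod_{l=1}^N\lambda_l^{\alpha_1}(1-\lambda_l)^{\alpha_2}\prod_{1\le j<k\le N}|\lambda_k-\lambda_j|^\beta$. Here $\beta=2\alpha/N$ with $\alpha,\alpha_1,\alpha_2$ fixed, and $N\to\infty$. Standing assumption (large-$N$ ansatz): for every $n\ge1$ and all integers $p_1,\dots,p_n\ge0$, the joint cumulant of $\sum_j\lambda_j^{p_1},\dots,\sum_j\lambda_j^{p_n}$ (with $\beta=2\alpha/N$) has, as $N\to\infty$, an asymptotic expansion $N\sum_{l\ge0}c^{(l)}_{p_1,\dots,p_n}N^{-l}$ with coefficients independent of $N$. $m^{\rm J}_{p,0},m^{\rm J}_{p,1}$ are defined by $\frac1N\big\langle\sum_{j=1}^N\lambda_j^p\big\rangle=m^{\rm J}_{p,0}+\frac1Nm^{\rm J}_{p,1}+O(N^{-2})$; $\mu^{\rm J}_{(p,q),0}=\lim_{N\to\infty}\frac1N{\rm Cov}\big(\sum_i\lambda_i^p,\sum_i\lambda_i^q\big)$; $\tilde\mu^{\rm J}_{p,0}=\sum_{p_1+q_1=p,\;p_1,q_1\ge0}\mu^{\rm J}_{(p_1,q_1),0}$. Empty sums are zero. *)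

theory Defs
  imports "HOL-Probability.Probability" "HOL-Library.Landau_Symbols"
begin

section \<open>Covariance and joint cumulants\<close>

definition covariance :: "'a measure \<Rightarrow> ('a \<Rightarrow> real) \<Rightarrow> ('a \<Rightarrow> real) \<Rightarrow> real" where
  "covariance M X Y =
     (LINT \<omega>|M. X \<omega> * Y \<omega>) - (LINT \<omega>|M. X \<omega>) * (LINT \<omega>|M. Y \<omega>)"

text \<open>Leonov--Shiryaev (moment--cumulant) formula for the joint cumulant of the finite family
  \<open>(X i)\<close>, \<open>i \<in> I\<close>: the sum runs over all set partitions of \<open>I\<close>.\<close>

definition joint_cumulant :: "'a measure \<Rightarrow> 'i set \<Rightarrow> ('i \<Rightarrow> 'a \<Rightarrow> real) \<Rightarrow> real" where
  "joint_cumulant M I X =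
     (\<Sum>P | partition_on I P. (-1) ^ (card P - 1) * fact (card P - 1) *
        (\<Prod>B\<in>P. LINT \<omega>|M. (\<Prod>i\<in>B. X i \<omega>)))"

section \<open>The Jacobi beta-ensemble\<close>

text \<open>Configurations are functions on \<open>{..<N}\<close>. The value \<open>0 powr b = 0\<close> only matters on
  the diagonals, which are null sets.\<close>

definition jacobi_weight :: "nat \<Rightarrow> real \<Rightarrow> real \<Rightarrow> real \<Rightarrow> (nat \<Rightarrow> real) \<Rightarrow> real" where
  "jacobi_weight N \<beta> \<alpha>1 \<alpha>2 x =
     (\<Prod>l<N. x l powr \<alpha>1 * (1 - x l) powr \<alpha>2) *
     (\<Prod>k<N. \<Prod>j<k. \<bar>x k - x j\<bar> powr \<beta>)"

definition open_unit_cube :: "nat \<Rightarrow> (nat \<Rightarrow> real) set" where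
  "open_unit_cube N = PiE {..<N} (\<lambda>_. {0<..<1})"

definition jacobi_norm :: "nat \<Rightarrow> real \<Rightarrow> real \<Rightarrow> real \<Rightarrow> real" where
  "jacobi_norm N \<beta> \<alpha>1 \<alpha>2 =
     (LINT x|PiM {..<N} (\<lambda>_. lborel).
        indicator (open_unit_cube N) x * jacobi_weight N \<beta> \<alpha>1 \<alpha>2 x)"

definition jacobi_ensemble :: "nat \<Rightarrow> real \<Rightarrow> real \<Rightarrow> real \<Rightarrow> (nat \<Rightarrow> real) measure" where
  "jacobi_ensemble N \<beta> \<alpha>1 \<alpha>2 =
     density (PiM {..<N} (\<lambda>_. lborel))
       (\<lambda>x. ennreal (indicator (open_unit_cube N) x * jacobi_weight N \<beta> \<alpha>1 \<alpha>2 x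
                      / jacobi_norm N \<beta> \<alpha>1 \<alpha>2))"

definition power_sum :: "nat \<Rightarrow> nat \<Rightarrow> (nat \<Rightarrow> real) \<Rightarrow> real" where
  "power_sum N p x = (\<Sum>j<N. x j ^ p)"

abbreviation high_temp_jacobi :: "real \<Rightarrow> real \<Rightarrow> real \<Rightarrow> nat \<Rightarrow> (nat \<Rightarrow> real) measure" where
  "high_temp_jacobi \<alpha> \<alpha>1 \<alpha>2 N \<equiv> jacobi_ensemble N (2 * \<alpha> / real N) \<alpha>1 \<alpha>2"

section \<open>Large-N expansions\<close>

text \<open>\<open>f(N)\<close> has the asymptotic (not necessarily convergent) expansion
  \<open>N * (c 0 + c 1 / N + c 2 / N^2 + ...)\<close>.\<close>

definition has_large_N_expansion :: "(nat \<Rightarrow> real) \<Rightarrow> (nat \<Rightarrow> real) \<Rightarrow> bool" where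
  "has_large_N_expansion f c \<longleftrightarrow>
     (\<forall>L. (\<lambda>N. f N - real N * (\<Sum>l\<le>L. c l / real N ^ l))
            \<in> O(\<lambda>N. real N * (1 / real N ^ Suc L)))"

definition large_N_ansatz :: "real \<Rightarrow> real \<Rightarrow> real \<Rightarrow> bool" where
  "large_N_ansatz \<alpha> \<alpha>1 \<alpha>2 \<longleftrightarrow>
     (\<forall>n\<ge>1. \<forall>p::nat \<Rightarrow> nat. \<exists>c.
        has_large_N_expansion
          (\<lambda>N. joint_cumulant (high_temp_jacobi \<alpha> \<alpha>1 \<alpha>2 N) {..<n} (\<lambda>i. power_sum N (p i))) c)"

text \<open>The coefficients in \<open>f N = m0 + m1 / N + O(1 / N^2)\<close> are unique if they exist, which the
  ansatz guarantees for the moments below.\<close>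

definition two_term_expansion :: "(nat \<Rightarrow> real) \<Rightarrow> real \<Rightarrow> real \<Rightarrow> bool" where
  "two_term_expansion f m0 m1 \<longleftrightarrow>
     (\<lambda>N. f N - (m0 + 1 / real N * m1)) \<in> O(\<lambda>N. 1 / real N ^ 2)"

definition jacobi_moment :: "real \<Rightarrow> real \<Rightarrow> real \<Rightarrow> nat \<Rightarrow> nat \<Rightarrow> real" where
  "jacobi_moment \<alpha> \<alpha>1 \<alpha>2 p N =
     1 / real N * (LINT x|high_temp_jacobi \<alpha> \<alpha>1 \<alpha>2 N. power_sum N p x)"

definition jacobi_m0 :: "real \<Rightarrow> real \<Rightarrow> real \<Rightarrow> nat \<Rightarrow> real" where
  "jacobi_m0 \<alpha> \<alpha>1 \<alpha>2 p =
     (THE m0. \<exists>m1. two_term_expansion (jacobi_moment \<alpha> \<alpha>1 \<alpha>2 p) m0 m1)"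

definition jacobi_m1 :: "real \<Rightarrow> real \<Rightarrow> real \<Rightarrow> nat \<Rightarrow> real" where
  "jacobi_m1 \<alpha> \<alpha>1 \<alpha>2 p =
     (THE m1. \<exists>m0. two_term_expansion (jacobi_moment \<alpha> \<alpha>1 \<alpha>2 p) m0 m1)"

definition jacobi_mu0 :: "real \<Rightarrow> real \<Rightarrow> real \<Rightarrow> nat \<Rightarrow> nat \<Rightarrow> real" where
  "jacobi_mu0 \<alpha> \<alpha>1 \<alpha>2 p q =
     lim (\<lambda>N. 1 / real N *
        covariance (high_temp_jacobi \<alpha> \<alpha>1 \<alpha>2 N) (power_sum N p) (power_sum N q))"

definition jacobi_mu_tilde0 :: "real \<Rightarrow> real \<Rightarrow> real \<Rightarrow> nat \<Rightarrow> real" where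
  "jacobi_mu_tilde0 \<alpha> \<alpha>1 \<alpha>2 p =
     (\<Sum>(p1, q1) | p1 + q1 = p. jacobi_mu0 \<alpha> \<alpha>1 \<alpha>2 p1 q1)"

end

(* The loop equations come from the invariance of the partition function under the coordinatewise
   substitution y -> y + t (y - y^(p+1)) of the unit cube, with a power sum of exponent q as observable:
   the pulled-back weight is the weight times a factor with a uniform first-order expansion in t, and
   the coefficient of t must integrate to zero. The symmetrised interaction turns into the products
   of the power sums of exponents a and p - a. For q = 0 the orders 1 and 1/N of the loop equation
   give the recursion for the corrections; for general q its leading order gives, after subtraction
   of the disconnected part,
     (p + 1 + a1 + a2 + 2 a) mu(p,q) + 2 a sum_{s=1}^{p-1} m(p-s) mu(s,q) + a2 sum_{s=1}^{p-1} mu(s,q)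
       = q (m(q) - m(p+q)),
   because the third cumulants are of order N. Summing over p + q = n yields the second recursion. *)
theory Submission
  imports Defs "HOL-Real_Asymp.Real_Asymp"
begin

section \<open>The ensemble as a density over the uniform cube\<close>

text \<open>The obstacle is \<alpha> < 0: then \<open>\<beta>\<close> is negative and the weight
  blows up on the diagonals as well as, possibly, at the faces of the cube. Bochner integrals of
  non-integrable functions are 0, so integrability and a positive normalisation must be secured
  before any identity has content; the lower bound on \<alpha> makes this possible for every N > 0.
  The field y - y^(p+1) vanishes at 0 and 1, so its quotients by y and by 1 - y and its divided
  differences are polynomials, and for small t the factor acquired by the weight stays bounded near
  every singularity. Since \<open>\<beta>\<close> is 2 \<alpha> / N, the roughly N^2 / 2 pairs
  contribute to the loop equation at the same order as the N one-body factors. The ansatz is applied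
  to one, two and three power sums: it supplies the coefficients, the limiting covariances, and the
  vanishing of third cumulants over N^2, which closes an otherwise open hierarchy. The term p / 2 of
  the second recursion is the mean of p over p + q = n, by symmetry of the covariances.\<close>

lemma PiM_density_lborel:
  fixes f :: "real \<Rightarrow> ennreal"
  assumes "finite I" and [measurable]: "f \<in> borel_measurable borel"
    and "prob_space (density lborel f)"
  shows "PiM I (\<lambda>_. density lborel f) = density (PiM I (\<lambda>_. lborel)) (\<lambda>x. \<Prod>i\<in>I. f (x i))"
proof -
  interpret P: prob_space "density lborel f" by fact
  interpret D: product_sigma_finite "\<lambda>_. density lborel f"
    by (simp add: product_sigma_finite_def P.sigma_finite_measure_axioms)
  interpret L: product_sigma_finite "\<lambda>_. lborel :: real measure"
    by (simp add: product_sigma_finite_def lborel.sigma_finite_measure_axioms)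
  have "density (PiM I (\<lambda>_. lborel)) (\<lambda>x. \<Prod>i\<in>I. f (x i)) = PiM I (\<lambda>_. density lborel f)"
  \<comment> \<open>Both measures are compared on boxes. Uniqueness needs sigma-finite factors; this
    is where the total mass one of the density enters.\<close>
  proof (rule D.PiM_eqI)
    show "finite I" by fact
    show "sets (density (PiM I (\<lambda>_. lborel)) (\<lambda>x. \<Prod>i\<in>I. f (x i))) = sets (PiM I (\<lambda>_. density lborel f))"
      by (simp cong: sets_PiM_cong)
    fix A :: "'a \<Rightarrow> real set" assume "\<And>i. i \<in> I \<Longrightarrow> A i \<in> sets (density lborel f)"
    then have A[measurable]: "\<And>i. i \<in> I \<Longrightarrow> A i \<in> sets borel" by simp
    have "emeasure (density (PiM I (\<lambda>_. lborel)) (\<lambda>x. \<Prod>i\<in>I. f (x i))) (Pi\<^sub>E I A)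
      = (\<integral>\<^sup>+x. (\<Prod>i\<in>I. f (x i)) * indicator (Pi\<^sub>E I A) x \<partial>PiM I (\<lambda>_. lborel))"
      using A \<open>finite I\<close> by (intro emeasure_density) (auto intro!: sets_PiM_I_finite)
    also have "\<dots> = (\<integral>\<^sup>+x. (\<Prod>i\<in>I. f (x i) * indicator (A i) (x i)) \<partial>PiM I (\<lambda>_. lborel))"
    proof (intro nn_integral_cong)
      fix x assume "x \<in> space (PiM I (\<lambda>_. lborel :: real measure))"
      then have "indicator (Pi\<^sub>E I A) x = (\<Prod>i\<in>I. indicator (A i) (x i) :: ennreal)"
        using \<open>finite I\<close> by (auto simp: indicator_def space_PiM PiE_iff prod_zero_iff)
      then show "(\<Prod>i\<in>I. f (x i)) * indicator (Pi\<^sub>E I A) x = (\<Prod>i\<in>I. f (x i) * indicator (A i) (x i))"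
        by (simp add: prod.distrib)
    qed
    also have "\<dots> = (\<Prod>i\<in>I. \<integral>\<^sup>+x. f x * indicator (A i) x \<partial>lborel)"
      using \<open>finite I\<close> A by (intro L.product_nn_integral_prod) auto
    also have "\<dots> = (\<Prod>i\<in>I. emeasure (density lborel f) (A i))"
      using A by (intro prod.cong) (auto simp: emeasure_density)
    finally show "emeasure (density (PiM I (\<lambda>_. lborel)) (\<lambda>x. \<Prod>i\<in>I. f (x i))) (Pi\<^sub>E I A) =
      (\<Prod>i\<in>I. emeasure (density lborel f) (A i))" .
  qed
  then show ?thesis by simp
qed

abbreviation unit_uniform :: "real measure" where
  "unit_uniform \<equiv> density lborel (indicator {0<..<1})"

text \<open>This is the reference measure for all integrals: its factors are probability measures,
  as the pushforward of a product requires, and integrands no longer carry the indicator of the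
  cube.\<close>

abbreviation cube_uniform :: "nat \<Rightarrow> (nat \<Rightarrow> real) measure" where
  "cube_uniform N \<equiv> PiM {..<N} (\<lambda>_. unit_uniform)"

lemma prob_space_unit_uniform: "prob_space unit_uniform"
  by (rule prob_spaceI) (simp add: emeasure_density)

lemma sets_cube_uniform: "sets (cube_uniform N) = sets (PiM {..<N} (\<lambda>_. borel))"
  by (intro sets_PiM_cong) auto

lemma sets_PiM_lborel: "sets (PiM {..<N} (\<lambda>_. lborel :: real measure)) = sets (PiM {..<N} (\<lambda>_. borel))"
  by (intro sets_PiM_cong) auto

lemma measurable_cube_uniform:
  "borel_measurable (cube_uniform N) = borel_measurable (PiM {..<N} (\<lambda>_. borel))"
  by (intro measurable_cong_sets sets_cube_uniform refl)

lemma cube_uniform_eq_density: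
  "cube_uniform N = density (PiM {..<N} (\<lambda>_. lborel)) (indicator (open_unit_cube N))"
proof -
  have "cube_uniform N = density (PiM {..<N} (\<lambda>_. lborel)) (\<lambda>x. \<Prod>i<N. indicator {0<..<1} (x i))"
    by (intro PiM_density_lborel prob_space_unit_uniform) auto
  also have "\<dots> = density (PiM {..<N} (\<lambda>_. lborel)) (indicator (open_unit_cube N))"
  proof (intro density_cong AE_I2)
    show "indicator (open_unit_cube N) \<in> borel_measurable (Pi\<^sub>M {..<N} (\<lambda>_. lborel))"
      unfolding open_unit_cube_def by (intro borel_measurable_indicator sets_PiM_I_finite) auto
    fix x assume "x \<in> space (PiM {..<N} (\<lambda>_. lborel :: real measure))"
    then show "(\<Prod>i<N. indicator {0<..<1} (x i)) = (indicator (open_unit_cube N) x :: ennreal)"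
      by (auto simp: indicator_def space_PiM PiE_iff prod_zero_iff open_unit_cube_def)
  qed simp
  finally show ?thesis .
qed

lemma AE_cube_uniform: "AE x in cube_uniform N. x \<in> open_unit_cube N"
proof -
  have "open_unit_cube N \<in> sets (PiM {..<N} (\<lambda>_. lborel))"
    unfolding open_unit_cube_def by (intro sets_PiM_I_finite) auto
  then show ?thesis
    unfolding cube_uniform_eq_density by (subst AE_density) (auto simp: indicator_def)
qed

lemma measurable_jacobi_weight [measurable]:
  "jacobi_weight N \<beta> \<alpha>1 \<alpha>2 \<in> borel_measurable (PiM {..<N} (\<lambda>_. borel))"
proof -
  have "(\<lambda>x. \<Prod>j<k. \<bar>x k - x j\<bar> powr \<beta>) \<in> borel_measurable (PiM {..<N} (\<lambda>_. borel))" if "k < N" for k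
    using that by (intro borel_measurable_prod) auto
  then show ?thesis
    unfolding jacobi_weight_def
    by (intro borel_measurable_times borel_measurable_prod) auto
qed

lemma jacobi_weight_nonneg [simp]: "jacobi_weight N \<beta> \<alpha>1 \<alpha>2 x \<ge> 0"
  unfolding jacobi_weight_def by (intro mult_nonneg_nonneg prod_nonneg) auto

lemma integral_cube_uniform:
  fixes g :: "(nat \<Rightarrow> real) \<Rightarrow> real"
  assumes "g \<in> borel_measurable (PiM {..<N} (\<lambda>_. borel))"
  shows "(LINT x|cube_uniform N. g x) = (LINT x|PiM {..<N} (\<lambda>_. lborel). indicator (open_unit_cube N) x * g x)"
proof -
  have C: "open_unit_cube N \<in> sets (PiM {..<N} (\<lambda>_. lborel))"
    unfolding open_unit_cube_def by (intro sets_PiM_I_finite) auto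
  have g: "g \<in> borel_measurable (PiM {..<N} (\<lambda>_. lborel))"
    using assms measurable_cong_sets[OF sets_PiM_lborel refl] by blast
  have "(LINT x|density (PiM {..<N} (\<lambda>_. lborel)) (\<lambda>x. ennreal (indicator (open_unit_cube N) x)). g x)
    = (LINT x|PiM {..<N} (\<lambda>_. lborel). indicator (open_unit_cube N) x * g x)"
    using C g by (subst integral_density) (auto intro!: borel_measurable_indicator)
  then show ?thesis
    unfolding cube_uniform_eq_density by (simp add: ennreal_indicator)
qed

lemma jacobi_norm_eq: "jacobi_norm N \<beta> \<alpha>1 \<alpha>2 = (LINT x|cube_uniform N. jacobi_weight N \<beta> \<alpha>1 \<alpha>2 x)"
  unfolding jacobi_norm_def by (subst integral_cube_uniform) auto

lemma jacobi_ensemble_eq: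
  "jacobi_ensemble N \<beta> \<alpha>1 \<alpha>2 =
   density (cube_uniform N) (\<lambda>x. ennreal (jacobi_weight N \<beta> \<alpha>1 \<alpha>2 x / jacobi_norm N \<beta> \<alpha>1 \<alpha>2))"
proof -
  have C: "open_unit_cube N \<in> sets (PiM {..<N} (\<lambda>_. lborel))"
    unfolding open_unit_cube_def by (intro sets_PiM_I_finite) auto
  have w: "jacobi_weight N \<beta> \<alpha>1 \<alpha>2 \<in> borel_measurable (PiM {..<N} (\<lambda>_. lborel))"
    using measurable_jacobi_weight measurable_cong_sets[OF sets_PiM_lborel refl] by blast
  show ?thesis
    unfolding cube_uniform_eq_density jacobi_ensemble_def using C w
    by (subst density_density_eq) (auto intro!: density_cong borel_measurable_indicator simp: indicator_def)
qed

text \<open>The substitution acts coordinatewise, so the N-dimensional change of variables reduces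
  to dimension one: the density \<open>\<phi>'\<close> on the unit interval is pushed forward by
  \<open>\<phi>\<close> to the uniform distribution, and a product of pushforwards is the
  pushforward of the product.\<close>

lemma integral_cube_uniform_substitution:
  fixes \<phi> \<phi>' :: "real \<Rightarrow> real" and F :: "(nat \<Rightarrow> real) \<Rightarrow> real"
  assumes deriv: "\<And>x. (\<phi> has_real_derivative \<phi>' x) (at x)"
    and cont: "continuous_on UNIV \<phi>'"
    and pos: "\<And>x. x \<in> {0..1} \<Longrightarrow> \<phi>' x \<ge> 0"
    and ends: "\<phi> 0 = 0" "\<phi> 1 = 1" and inner: "\<And>x. x \<in> {0<..<1} \<Longrightarrow> \<phi> x \<in> {0<..<1}"
    and F: "F \<in> borel_measurable (PiM {..<N} (\<lambda>_. borel))"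
  shows "(LINT x|cube_uniform N. F x) =
    (LINT x|cube_uniform N. (\<Prod>i<N. \<phi>' (x i)) * F (compose {..<N} \<phi> x))"
proof -
  define f where "f = (\<lambda>x. ennreal (\<phi>' x) * indicator {0<..<1} x)"
  have \<phi>'[measurable]: "\<phi>' \<in> borel_measurable borel" using cont by (rule borel_measurable_continuous_onI)
  have \<phi>[measurable]: "\<phi> \<in> borel_measurable borel"
    by (intro borel_measurable_continuous_onI DERIV_continuous_on) (auto intro: deriv has_field_derivative_at_within)
  have f[measurable]: "f \<in> borel_measurable borel" unfolding f_def by measurable
  have D: "distr (density lborel f) unit_uniform \<phi> = unit_uniform"
  proof (rule measure_eqI)
    fix A assume "A \<in> sets (distr (density lborel f) unit_uniform \<phi>)"
    then have A[measurable]: "A \<in> sets borel" by simp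
    \<comment> \<open>Cutting \<open>A\<close> down to the open interval makes \<open>h\<close>
      vanish at 0 and 1, so the substitution rule on the closed interval can be used without
      tracking the endpoints.\<close>
    define h where "h = (indicator (A \<inter> {0<..<1}) :: real \<Rightarrow> real)"
    have [measurable]: "h \<in> borel_measurable borel" unfolding h_def by auto
    have "emeasure unit_uniform A = (\<integral>\<^sup>+x. indicator {0<..<1} x * indicator A x \<partial>lborel)"
      by (subst emeasure_density) auto
    also have "\<dots> = (\<integral>\<^sup>+x. ennreal (h x) * indicator {\<phi> 0..\<phi> 1} x \<partial>lborel)"
      by (intro nn_integral_cong) (auto simp: h_def indicator_def ends)
    also have "\<dots> = (\<integral>\<^sup>+x. ennreal (h (\<phi> x) * \<phi>' x * indicator {0..1} x) \<partial>lborel)"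
      using nn_integral_substitution[where f=h and g=\<phi> and g'=\<phi>' and a=0 and b=1] cont pos
      by (auto simp: nn_integral_set_ennreal set_borel_measurable_def deriv intro: continuous_on_subset)
    also have "\<dots> = (\<integral>\<^sup>+x. f x * indicator (\<phi> -` A) x \<partial>lborel)"
    proof (intro nn_integral_cong)
      fix x :: real
      show "ennreal (h (\<phi> x) * \<phi>' x * indicator {0..1} x) = f x * indicator (\<phi> -` A) x"
      proof (cases "x \<in> {0<..<1}")
        case True
        then show ?thesis using inner[OF True] by (auto simp: h_def f_def indicator_def)
      next
        case False
        then have "x \<notin> {0..1} \<or> x = 0 \<or> x = 1" by auto
        with False show ?thesis by (auto simp: h_def f_def indicator_def ends)
      qed
    qed
    also have "\<dots> = emeasure (density lborel f) (\<phi> -` A)"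
      by (subst emeasure_density) (auto intro!: measurable_sets_borel[OF \<phi>])
    also have "\<dots> = emeasure (distr (density lborel f) unit_uniform \<phi>) A"
      by (subst emeasure_distr) auto
    finally show "emeasure (distr (density lborel f) unit_uniform \<phi>) A = emeasure unit_uniform A" by simp
  qed simp
  have P: "prob_space (density lborel f)"
  proof (rule prob_spaceI)
    have "emeasure (density lborel f) (space (density lborel f))
      = emeasure (distr (density lborel f) unit_uniform \<phi>) UNIV"
      by (subst emeasure_distr) auto
    also have "\<dots> = 1" unfolding D using prob_space.emeasure_space_1[OF prob_space_unit_uniform] by simp
    finally show "emeasure (density lborel f) (space (density lborel f)) = 1" .
  qed
  have Q: "cube_uniform N = distr (PiM {..<N} (\<lambda>_. density lborel f)) (cube_uniform N) (compose {..<N} \<phi>)"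
    using distr_PiM_finite_prob_space'[of "{..<N}" "\<lambda>_. density lborel f" "\<lambda>_. unit_uniform" \<phi>]
    by (simp add: D P prob_space_unit_uniform)
  \<comment> \<open>Outside the unit interval the sign of \<open>\<phi>'\<close> is unknown.
    \<open>max 0\<close> is the real counterpart of the truncation done by \<open>ennreal\<close>;
    on the cube it disappears again.\<close>
  have fd: "PiM {..<N} (\<lambda>_. density lborel f) = density (cube_uniform N) (\<lambda>x. ennreal (\<Prod>i<N. max 0 (\<phi>' (x i))))"
  proof -
    have "PiM {..<N} (\<lambda>_. density lborel f) = density (PiM {..<N} (\<lambda>_. lborel)) (\<lambda>x. \<Prod>i<N. f (x i))"
      by (intro PiM_density_lborel P) auto
    also have "\<dots> = density (PiM {..<N} (\<lambda>_. lborel))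
        (\<lambda>x. (\<Prod>i<N. indicator {0<..<1} (x i)) * ennreal (\<Prod>i<N. max 0 (\<phi>' (x i))))"
      by (intro density_cong AE_I2)
        (auto simp: f_def prod.distrib prod_ennreal[symmetric] mult.commute ennreal_max_0 max.commute)
    also have "\<dots> = density (density (PiM {..<N} (\<lambda>_. lborel)) (\<lambda>x. \<Prod>i<N. indicator {0<..<1} (x i)))
         (\<lambda>x. ennreal (\<Prod>i<N. max 0 (\<phi>' (x i))))"
      by (subst density_density_eq) auto
    also have "density (PiM {..<N} (\<lambda>_. lborel)) (\<lambda>x. \<Prod>i<N. indicator {0<..<1} (x i)) = cube_uniform N"
      by (intro PiM_density_lborel[symmetric] prob_space_unit_uniform) auto
    finally show ?thesis .
  qed
  have m: "compose {..<N} \<phi> \<in> measurable (PiM {..<N} (\<lambda>_. density lborel f)) (cube_uniform N)"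
    unfolding compose_def by measurable
  have m': "compose {..<N} \<phi> \<in> measurable (cube_uniform N) (cube_uniform N)"
    unfolding compose_def by measurable
  have F': "F \<in> borel_measurable (cube_uniform N)"
    using F by (simp add: measurable_cube_uniform)
  have "(LINT x|cube_uniform N. F x) = (LINT x|PiM {..<N} (\<lambda>_. density lborel f). F (compose {..<N} \<phi> x))"
    by (subst Q, rule integral_distr[OF m F'])
  also have "\<dots> = (LINT x|cube_uniform N. (\<Prod>i<N. max 0 (\<phi>' (x i))) * F (compose {..<N} \<phi> x))"
    unfolding fd using measurable_compose[OF m' F']
    by (subst integral_density) (auto intro!: prod_nonneg)
  also have "\<dots> = (LINT x|cube_uniform N. (\<Prod>i<N. \<phi>' (x i)) * F (compose {..<N} \<phi> x))"
  proof (rule integral_cong_AE)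
    show "AE x in cube_uniform N. (\<Prod>i<N. max 0 (\<phi>' (x i))) * F (compose {..<N} \<phi> x)
        = (\<Prod>i<N. \<phi>' (x i)) * F (compose {..<N} \<phi> x)"
      using AE_cube_uniform
    proof eventually_elim
      case (elim x)
      then have "max 0 (\<phi>' (x i)) = \<phi>' (x i)" if "i < N" for i
      proof -
        have "x i \<in> {0<..<1}" using elim that by (auto simp: open_unit_cube_def PiE_iff)
        then have "\<phi>' (x i) \<ge> 0" using pos[of "x i"] by auto
        then show ?thesis by simp
      qed
      then show ?case by simp
    qed
  qed (use measurable_compose[OF m' F'] in auto)
  finally show ?thesis .
qed

section \<open>Integrability of the weight\<close>

text \<open>Translated by -c, the unit interval lies inside [-1, 1], so one integral over [-1, 1]
  serves all centres c. It is twice an integral over [0, 1], finite because e > -1.\<close>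

lemma nn_integral_abs_powr_le:
  fixes e :: real assumes "e > -1"
  shows "\<exists>K<\<top>. \<forall>c\<in>{0..1}. (\<integral>\<^sup>+x. ennreal (\<bar>x - c\<bar> powr e) \<partial>unit_uniform) \<le> K"
proof (intro exI conjI ballI)
  let ?J = "\<integral>\<^sup>+x. indicator {0..1} x * ennreal (x powr e) \<partial>lborel"
  let ?K = "\<integral>\<^sup>+x. indicator {-1..1} x * ennreal (\<bar>x\<bar> powr e) \<partial>lborel"
  have "?J = ennreal (1 powr (e + 1) / (e + 1))"
    using nn_integral_has_integral_lebesgue[OF _ has_integral_powr_from_0[of e 1]] assms
    by (simp add: ennreal_mult'' ennreal_indicator)
  then have J: "?J < \<top>" by simp
  have "?K \<le> (\<integral>\<^sup>+x. indicator {0..1} x * ennreal (x powr e) + indicator {0..1} (-x) * ennreal ((-x) powr e) \<partial>lborel)"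
    by (intro nn_integral_mono) (auto simp: indicator_def abs_if)
  also have "\<dots> = ?J + (\<integral>\<^sup>+x. indicator {0..1} (-x) * ennreal ((-x) powr e) \<partial>lborel)"
    by (subst nn_integral_add) auto
  also have "(\<integral>\<^sup>+x. indicator {0..1} (-x) * ennreal ((-x) powr e) \<partial>lborel) = ?J"
    by (subst (2) nn_integral_real_affine[of _ "-1" 0]) auto
  also have "?J + ?J < \<top>" using J by simp
  finally show "?K < \<top>" .
  fix c :: real assume c: "c \<in> {0..1}"
  have "(\<integral>\<^sup>+x. ennreal (\<bar>x - c\<bar> powr e) \<partial>unit_uniform)
    = (\<integral>\<^sup>+x. indicator {0<..<1} x * ennreal (\<bar>x - c\<bar> powr e) \<partial>lborel)"
    by (subst nn_integral_density) auto
  also have "\<dots> = (\<integral>\<^sup>+x. indicator {0<..<1} (c + x) * ennreal (\<bar>x\<bar> powr e) \<partial>lborel)"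
    by (subst nn_integral_real_affine[of _ 1 c]) auto
  also have "\<dots> \<le> ?K"
    using c by (intro nn_integral_mono) (auto simp: indicator_def)
  finally show "(\<integral>\<^sup>+x. ennreal (\<bar>x - c\<bar> powr e) \<partial>unit_uniform) \<le> ?K" .
qed

text \<open>Both exponents are at most 0, so replacing the larger base by the smaller one increases
  the product and merges the two powers; the sum covers both cases.\<close>

lemma powr_mult_le_sum:
  fixes s x a g :: real
  assumes "0 \<le> s" "0 < x" "a \<le> 0" "0 \<le> g"
  shows "s powr - g * x powr a \<le> s powr (a - g) + x powr (a - g)"
proof (cases "s = 0")
  \<comment> \<open>Here \<open>0 powr - g\<close> is 0 by convention, so the left side
    vanishes.\<close>
  case True then show ?thesis by simp
next
  case False
  then have s: "s > 0" using assms by simp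
  have *: "a - g = - g + a" by simp
  show ?thesis
  proof (cases "s \<le> x")
    case True
    then have "s powr - g * x powr a \<le> s powr - g * s powr a"
      using s assms by (intro mult_left_mono powr_mono2') auto
    also have "\<dots> = s powr (a - g)" unfolding * powr_add ..
    finally show ?thesis by (simp add: add_increasing2)
  next
    case False
    then have "s powr - g * x powr a \<le> x powr - g * x powr a"
      using s assms by (intro mult_right_mono powr_mono2') auto
    also have "\<dots> = x powr (a - g)" unfolding * powr_add ..
    finally show ?thesis by (simp add: add_increasing)
  qed
qed

text \<open>The two endpoint singularities never act together: on each half of the interval the
  factor of the far endpoint has base at least 1/2. Positive exponents are first lowered to 0, which
  only enlarges powers of numbers below 1.\<close>

lemma beta_weight_le:
  fixes x \<alpha>1 \<alpha>2 :: real
  assumes x: "0 < x" "x < 1"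
  defines "a \<equiv> min \<alpha>1 0" and "b \<equiv> min \<alpha>2 0"
  shows "x powr \<alpha>1 * (1 - x) powr \<alpha>2 \<le> 2 powr (-a-b) * (x powr a + (1 - x) powr b)"
proof -
  have half: "y powr c \<le> 2 powr (-c)" if "c \<le> 0" "1/2 \<le> y" for c y :: real
  proof -
    have "y powr c \<le> (1/2) powr c" using that by (intro powr_mono2') auto
    also have "\<dots> = 2 powr (-c)" by (simp add: powr_divide powr_minus_divide)
    finally show ?thesis .
  qed
  have ab: "a \<le> 0" "b \<le> 0" by (auto simp: a_def b_def)
  have A: "2 powr (-b) \<le> 2 powr (-a-b)" and B: "2 powr (-a) \<le> 2 powr (-a-b)"
    using ab by (auto intro!: powr_mono)
  have "x powr \<alpha>1 * (1 - x) powr \<alpha>2 \<le> x powr a * (1 - x) powr b"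
    using x by (intro mult_mono powr_mono') (auto simp: a_def b_def)
  also have "\<dots> \<le> 2 powr (-a-b) * (x powr a + (1 - x) powr b)"
  proof (cases "x \<le> 1/2")
    case True
    then have "(1 - x) powr b \<le> 2 powr (-a-b)" using ab by (intro order_trans[OF half A]) auto
    then have "x powr a * (1 - x) powr b \<le> 2 powr (-a-b) * x powr a"
      by (subst mult.commute, intro mult_right_mono) auto
    then show ?thesis by (auto simp: distrib_left intro: add_increasing2)
  next
    case False
    then have "x powr a \<le> 2 powr (-a-b)" using ab by (intro order_trans[OF half B]) auto
    then have "x powr a * (1 - x) powr b \<le> 2 powr (-a-b) * (1 - x) powr b"
      by (intro mult_right_mono) auto
    then show ?thesis by (auto simp: distrib_left intro: add_increasing)
  qed
  finally show ?thesis .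
qed

lemma AE_unit_uniform: "AE x in unit_uniform. 0 < x \<and> x < 1"
  by (subst AE_density) (auto simp: indicator_def)

lemma nn_integral_beta_weight_finite:
  fixes \<alpha>1 \<alpha>2 :: real
  assumes "\<alpha>1 > -1" "\<alpha>2 > -1"
  shows "(\<integral>\<^sup>+x. ennreal (x powr \<alpha>1 * (1 - x) powr \<alpha>2) \<partial>unit_uniform) < \<top>"
proof -
  define a b where "a = min \<alpha>1 0" and "b = min \<alpha>2 0"
  have "a > -1" "b > -1" using assms by (auto simp: a_def b_def)
  then obtain Ka Kb where K: "Ka < \<top>" "(\<integral>\<^sup>+x. ennreal (\<bar>x - 0\<bar> powr a) \<partial>unit_uniform) \<le> Ka"
    "Kb < \<top>" "(\<integral>\<^sup>+x. ennreal (\<bar>x - 1\<bar> powr b) \<partial>unit_uniform) \<le> Kb"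
    using nn_integral_abs_powr_le[of a] nn_integral_abs_powr_le[of b] by (metis atLeastAtMost_iff order_refl zero_le_one)
  have "(\<integral>\<^sup>+x. ennreal (x powr \<alpha>1 * (1 - x) powr \<alpha>2) \<partial>unit_uniform)
    \<le> (\<integral>\<^sup>+x. ennreal (2 powr (-a-b)) * (ennreal (\<bar>x - 0\<bar> powr a) + ennreal (\<bar>x - 1\<bar> powr b)) \<partial>unit_uniform)"
  proof (intro nn_integral_mono_AE)
    show "AE x in unit_uniform. ennreal (x powr \<alpha>1 * (1 - x) powr \<alpha>2)
      \<le> ennreal (2 powr (-a-b)) * (ennreal (\<bar>x - 0\<bar> powr a) + ennreal (\<bar>x - 1\<bar> powr b))"
      using AE_unit_uniform
    proof eventually_elim
      case (elim x)
      then show ?case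
        using beta_weight_le[of x \<alpha>1 \<alpha>2]
        by (auto simp: a_def[symmetric] b_def[symmetric] abs_minus_commute simp flip: ennreal_plus ennreal_mult'')
    qed
  qed
  also have "\<dots> \<le> ennreal (2 powr (-a-b)) * (Ka + Kb)"
    using K by (subst nn_integral_cmult, simp, subst nn_integral_add) (auto intro!: mult_left_mono add_mono)
  also have "\<dots> < \<top>" using K by (auto simp: ennreal_mult_less_top)
  finally show ?thesis .
qed

text \<open>At an endpoint the singularities of the two factors add up, whence the conditions \<open>g < 1 + \<alpha>\<^sub>i\<close>.\<close>

lemma nn_integral_beta_weight_dist_le:
  fixes \<alpha>1 \<alpha>2 g :: real
  assumes "\<alpha>1 > -1" "\<alpha>2 > -1" "0 \<le> g" "g < 1" "g < 1 + \<alpha>1" "g < 1 + \<alpha>2"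
  shows "\<exists>K<\<top>. \<forall>y\<in>{0<..<1}.
     (\<integral>\<^sup>+x. ennreal (x powr \<alpha>1 * (1 - x) powr \<alpha>2 * \<bar>y - x\<bar> powr - g) \<partial>unit_uniform) \<le> K"
proof -
  define a b where "a = min \<alpha>1 0" and "b = min \<alpha>2 0"
  have "a - g > -1" "b - g > -1" using assms by (auto simp: a_def b_def)
  then obtain Ka Kb where K: "Ka < \<top>" "\<And>c. c \<in> {0..1} \<Longrightarrow> (\<integral>\<^sup>+x. ennreal (\<bar>x - c\<bar> powr (a-g)) \<partial>unit_uniform) \<le> Ka"
    "Kb < \<top>" "\<And>c. c \<in> {0..1} \<Longrightarrow> (\<integral>\<^sup>+x. ennreal (\<bar>x - c\<bar> powr (b-g)) \<partial>unit_uniform) \<le> Kb"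
    using nn_integral_abs_powr_le[of "a-g"] nn_integral_abs_powr_le[of "b-g"] by metis
  show ?thesis
  proof (intro exI conjI ballI)
    show "ennreal (2 powr (-a-b)) * ((Ka + Ka) + (Kb + Kb)) < \<top>"
      using K by (auto simp: ennreal_mult_less_top)
    fix y :: real assume y: "y \<in> {0<..<1}"
    have "(\<integral>\<^sup>+x. ennreal (x powr \<alpha>1 * (1 - x) powr \<alpha>2 * \<bar>y - x\<bar> powr - g) \<partial>unit_uniform)
      \<le> (\<integral>\<^sup>+x. ennreal (2 powr (-a-b)) * ((ennreal (\<bar>x - y\<bar> powr (a-g)) + ennreal (\<bar>x - 0\<bar> powr (a-g)))
           + (ennreal (\<bar>x - y\<bar> powr (b-g)) + ennreal (\<bar>x - 1\<bar> powr (b-g)))) \<partial>unit_uniform)"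
    proof (intro nn_integral_mono_AE)
      show "AE x in unit_uniform. ennreal (x powr \<alpha>1 * (1 - x) powr \<alpha>2 * \<bar>y - x\<bar> powr - g)
        \<le> ennreal (2 powr (-a-b)) * ((ennreal (\<bar>x - y\<bar> powr (a-g)) + ennreal (\<bar>x - 0\<bar> powr (a-g)))
           + (ennreal (\<bar>x - y\<bar> powr (b-g)) + ennreal (\<bar>x - 1\<bar> powr (b-g))))"
        using AE_unit_uniform
      proof eventually_elim
        case (elim x)
        have "x powr \<alpha>1 * (1 - x) powr \<alpha>2 * \<bar>y - x\<bar> powr - g
          \<le> 2 powr (-a-b) * (x powr a + (1 - x) powr b) * \<bar>y - x\<bar> powr - g"
          using elim by (intro mult_right_mono beta_weight_le[of x \<alpha>1 \<alpha>2, folded a_def b_def]) auto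
        also have "\<dots> = 2 powr (-a-b) * (\<bar>y - x\<bar> powr - g * x powr a + \<bar>y - x\<bar> powr - g * (1 - x) powr b)"
          by (simp add: algebra_simps)
        also have "\<dots> \<le> 2 powr (-a-b) * ((\<bar>y - x\<bar> powr (a-g) + x powr (a-g)) + (\<bar>y - x\<bar> powr (b-g) + (1 - x) powr (b-g)))"
          using elim assms by (intro mult_left_mono add_mono powr_mult_le_sum) (auto simp: a_def b_def)
        finally show ?case
          using elim by (simp add: abs_minus_commute flip: ennreal_plus ennreal_mult'')
      qed
    qed
    also have "\<dots> \<le> ennreal (2 powr (-a-b)) * ((Ka + Ka) + (Kb + Kb))"
      using y K(2)[of y] K(2)[of 0] K(4)[of y] K(4)[of 1]
      by (subst nn_integral_cmult, simp, (subst nn_integral_add, simp, simp)+) (auto intro!: mult_left_mono add_mono)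
    finally show "(\<integral>\<^sup>+x. ennreal (x powr \<alpha>1 * (1 - x) powr \<alpha>2 * \<bar>y - x\<bar> powr - g) \<partial>unit_uniform)
      \<le> ennreal (2 powr (-a-b)) * ((Ka + Ka) + (Kb + Kb))" .
  qed
qed

section \<open>The interaction: from pairs to factors centred at a single variable\<close>

lemma prod_offdiagonal:
  fixes F :: "nat \<Rightarrow> nat \<Rightarrow> 'a::comm_monoid_mult"
  shows "(\<Prod>k<N. \<Prod>j\<in>{..<N}-{k}. F k j) = (\<Prod>k<N. \<Prod>j<k. F k j * F j k)"
proof (induction N)
  case (Suc N)
  have "(\<Prod>k<Suc N. \<Prod>j\<in>{..<Suc N}-{k}. F k j)
    = (\<Prod>k<N. \<Prod>j\<in>insert N ({..<N}-{k}). F k j) * (\<Prod>j<N. F N j)"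
  proof -
    have "{..<Suc N}-{k} = insert N ({..<N}-{k})" if "k < N" for k using that by auto
    moreover have "{..<Suc N}-{N} = {..<N}" by auto
    ultimately show ?thesis by simp
  qed
  also have "\<dots> = (\<Prod>k<N. F k N) * (\<Prod>k<N. \<Prod>j\<in>{..<N}-{k}. F k j) * (\<Prod>j<N. F N j)"
    by (simp add: prod.distrib)
  finally show ?case by (simp add: Suc prod.distrib mult_ac)
qed simp

lemma sum_symmetric_pairs:
  fixes F :: "nat \<Rightarrow> nat \<Rightarrow> 'a::comm_semiring_1"
  assumes "\<And>i j. F i j = F j i"
  shows "(\<Sum>k<N. \<Sum>j<N. F k j) = 2 * (\<Sum>k<N. \<Sum>j<k. F k j) + (\<Sum>k<N. F k k)"
proof (induction N)
  case (Suc N)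
  have "(\<Sum>k<N. F k N) = (\<Sum>k<N. F N k)" by (intro sum.cong refl assms)
  with Suc show ?case
    by (simp add: sum.distrib algebra_simps mult_2)
qed simp

text \<open>Distributing each pair over its two members, the interaction is a product of N N-th roots,
  hence at most the largest of the N factors; in each of these all variables but one decouple.\<close>

lemma interaction_le_sum:
  fixes x :: "nat \<Rightarrow> real"
  assumes N: "N > 0" and g: "0 \<le> g" "- g \<le> \<alpha>" and d: "\<And>k j. k < N \<Longrightarrow> j < N \<Longrightarrow> \<bar>x k - x j\<bar> \<le> 1"
  shows "(\<Prod>k<N. \<Prod>j<k. \<bar>x k - x j\<bar> powr (2 * \<alpha> / real N))
    \<le> (\<Sum>k<N. \<Prod>j\<in>{..<N}-{k}. \<bar>x k - x j\<bar> powr - g)"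
proof -
  define a where "a k = (\<Prod>j\<in>{..<N}-{k}. \<bar>x k - x j\<bar> powr - g)" for k
  have a: "a k \<ge> 0" for k unfolding a_def by (intro prod_nonneg) auto
  \<comment> \<open>Distances are at most 1, so the exponent may be lowered from 2 \<alpha> / N to
    -2 g / N; each member of the pair receives half of it.\<close>
  have "(\<Prod>k<N. \<Prod>j<k. \<bar>x k - x j\<bar> powr (2 * \<alpha> / real N))
    \<le> (\<Prod>k<N. \<Prod>j<k. \<bar>x k - x j\<bar> powr (- g / real N) * \<bar>x j - x k\<bar> powr (- g / real N))"
  proof (intro prod_mono conjI prod_nonneg)
    fix k j assume "k \<in> {..<N}" "j \<in> {..<k}"
    then have "\<bar>x k - x j\<bar> \<le> 1" using d by auto
    moreover have "- (2 * g / real N) \<le> 2 * \<alpha> / real N" using g N by (simp add: field_simps)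
    ultimately have "\<bar>x k - x j\<bar> powr (2 * \<alpha> / real N) \<le> \<bar>x k - x j\<bar> powr (- (2 * g / real N))"
      by (intro powr_mono') auto
    also have "- (2 * g / real N) = - g / real N + - g / real N" by simp
    finally show "\<bar>x k - x j\<bar> powr (2 * \<alpha> / real N)
      \<le> \<bar>x k - x j\<bar> powr (- g / real N) * \<bar>x j - x k\<bar> powr (- g / real N)"
      by (simp only: powr_add abs_minus_commute)
  qed auto
  also have "\<dots> = (\<Prod>k<N. \<Prod>j\<in>{..<N}-{k}. \<bar>x k - x j\<bar> powr (- g / real N))"
    by (rule prod_offdiagonal[symmetric])
  \<comment> \<open>The exponent -g / N turns the block centred at k into the N-th root of
    \<open>a k\<close>.\<close>
  also have "\<dots> = (\<Prod>k<N. a k powr (1 / real N))"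
    unfolding a_def by (intro prod.cong refl) (simp add: prod_powr_distrib powr_powr)
  \<comment> \<open>The sum stands in for the maximum of the \<open>a k\<close>: the N equal roots
    multiply back to it, and a sum can be integrated term by term.\<close>
  also have "\<dots> \<le> (\<Prod>k<N. (\<Sum>k<N. a k) powr (1 / real N))"
    using a by (intro prod_mono conjI powr_mono2) (auto intro: member_le_sum)
  also have "\<dots> = (\<Sum>k<N. a k)"
  proof (cases "(\<Sum>k<N. a k) = 0")
    case False
    then have "(\<Sum>k<N. a k) > 0" using a by (simp add: sum_nonneg order_less_le)
    then show ?thesis using N by (simp add: powr_realpow[symmetric] powr_powr)
  qed (use N in simp)
  finally show ?thesis unfolding a_def .
qed

lemma measurable_decoupled:
  assumes "k < N"
  shows "(\<lambda>x. (\<Prod>l<N. x l powr \<alpha>1 * (1 - x l) powr \<alpha>2) * (\<Prod>j\<in>{..<N}-{k}. \<bar>x k - x j\<bar> powr - g))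
    \<in> borel_measurable (PiM {..<N} (\<lambda>_. borel :: real measure))"
proof -
  have [measurable]: "(\<lambda>x. x l) \<in> borel_measurable (PiM {..<N} (\<lambda>_. borel :: real measure))" if "l < N" for l
    using that by simp
  show ?thesis
    using assms by (intro borel_measurable_times borel_measurable_prod) auto
qed

text \<open>Once the coordinate k is fixed at y, the integrand is a product of functions of the
  other coordinates, so the inner integral is a product of N - 1 one-variable integrals, each at
  most \<open>K\<close> uniformly in y. What remains is the beta weight in y.\<close>

lemma nn_integral_decoupled_finite:
  assumes "\<alpha>1 > -1" "\<alpha>2 > -1" "0 \<le> g" "g < 1" "g < 1 + \<alpha>1" "g < 1 + \<alpha>2" and k: "k < N"
  shows "(\<integral>\<^sup>+x. ennreal ((\<Prod>l<N. x l powr \<alpha>1 * (1 - x l) powr \<alpha>2) *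
      (\<Prod>j\<in>{..<N}-{k}. \<bar>x k - x j\<bar> powr - g)) \<partial>cube_uniform N) < \<top>"
proof -
  interpret U: prob_space unit_uniform by (rule prob_space_unit_uniform)
  interpret P: product_sigma_finite "\<lambda>_::nat. unit_uniform"
    by (simp add: product_sigma_finite_def U.sigma_finite_measure_axioms)
  obtain K where K: "K < \<top>" "\<And>y. y \<in> {0<..<1} \<Longrightarrow>
     (\<integral>\<^sup>+x. ennreal (x powr \<alpha>1 * (1 - x) powr \<alpha>2 * \<bar>y - x\<bar> powr - g) \<partial>unit_uniform) \<le> K"
    using nn_integral_beta_weight_dist_le[of \<alpha>1 \<alpha>2 g] assms by auto
  let ?v = "\<lambda>x::real. x powr \<alpha>1 * (1 - x) powr \<alpha>2"
  let ?I = "{..<N} - {k}"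
  let ?f = "\<lambda>x. ennreal ((\<Prod>l<N. ?v (x l)) * (\<Prod>j\<in>?I. \<bar>x k - x j\<bar> powr - g))"
  have ins: "insert k ?I = {..<N}" using k by auto
  have f: "?f \<in> borel_measurable (cube_uniform N)"
    using measurable_decoupled[OF k] by (simp add: measurable_cube_uniform)
  have "(\<integral>\<^sup>+x. ?f x \<partial>cube_uniform N)
    = (\<integral>\<^sup>+y. (\<integral>\<^sup>+x. ?f (x(k := y)) \<partial>PiM ?I (\<lambda>_. unit_uniform)) \<partial>unit_uniform)"
    using P.product_nn_integral_insert_rev[of ?I k ?f] f unfolding ins by simp
  also have "\<dots> = (\<integral>\<^sup>+y. ennreal (?v y) * (\<Prod>j\<in>?I. \<integral>\<^sup>+x. ennreal (?v x * \<bar>y - x\<bar> powr - g) \<partial>unit_uniform) \<partial>unit_uniform)"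
  proof (intro nn_integral_cong)
    fix y :: real
    have "?f (x(k := y)) = ennreal (?v y) * (\<Prod>j\<in>?I. ennreal (?v (x j) * \<bar>y - x j\<bar> powr - g))" for x
    proof -
      have "(\<Prod>l<N. ?v ((x(k := y)) l)) = ?v y * (\<Prod>l\<in>?I. ?v (x l))"
        using k by (subst prod.remove[of _ k]) (auto intro!: prod.cong)
      moreover have "(\<Prod>j\<in>?I. \<bar>(x(k := y)) k - (x(k := y)) j\<bar> powr - g) = (\<Prod>j\<in>?I. \<bar>y - x j\<bar> powr - g)"
        by (intro prod.cong) auto
      ultimately show ?thesis
        by (simp add: prod_ennreal prod.distrib prod_nonneg mult.assoc flip: ennreal_mult'')
    qed
    then have "(\<integral>\<^sup>+x. ?f (x(k := y)) \<partial>PiM ?I (\<lambda>_. unit_uniform))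
      = (\<integral>\<^sup>+x. ennreal (?v y) * (\<Prod>j\<in>?I. ennreal (?v (x j) * \<bar>y - x j\<bar> powr - g)) \<partial>PiM ?I (\<lambda>_. unit_uniform))"
      by simp
    also have "\<dots> = ennreal (?v y) * (\<integral>\<^sup>+x. (\<Prod>j\<in>?I. ennreal (?v (x j) * \<bar>y - x j\<bar> powr - g)) \<partial>PiM ?I (\<lambda>_. unit_uniform))"
      by (intro nn_integral_cmult) measurable
    also have "(\<integral>\<^sup>+x. (\<Prod>j\<in>?I. ennreal (?v (x j) * \<bar>y - x j\<bar> powr - g)) \<partial>PiM ?I (\<lambda>_. unit_uniform))
      = (\<Prod>j\<in>?I. \<integral>\<^sup>+x. ennreal (?v x * \<bar>y - x\<bar> powr - g) \<partial>unit_uniform)"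
      by (intro P.product_nn_integral_prod) auto
    finally show "(\<integral>\<^sup>+x. ?f (x(k := y)) \<partial>PiM ?I (\<lambda>_. unit_uniform))
      = ennreal (?v y) * (\<Prod>j\<in>?I. \<integral>\<^sup>+x. ennreal (?v x * \<bar>y - x\<bar> powr - g) \<partial>unit_uniform)" .
  qed
  also have "\<dots> \<le> (\<integral>\<^sup>+y. ennreal (?v y) * (\<Prod>j\<in>?I. K) \<partial>unit_uniform)"
  proof (intro nn_integral_mono_AE)
    show "AE y in unit_uniform. ennreal (?v y) * (\<Prod>j\<in>?I. \<integral>\<^sup>+x. ennreal (?v x * \<bar>y - x\<bar> powr - g) \<partial>unit_uniform)
      \<le> ennreal (?v y) * (\<Prod>j\<in>?I. K)"
      using AE_unit_uniform
    proof eventually_elim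
      case (elim y)
      then show ?case using K(2)[of y] by (intro mult_left_mono prod_mono_ennreal) auto
    qed
  qed
  also have "\<dots> = (\<integral>\<^sup>+y. ennreal (?v y) \<partial>unit_uniform) * K ^ card ?I"
    by (subst nn_integral_multc) auto
  also have "\<dots> < \<top>"
    using nn_integral_beta_weight_finite[of \<alpha>1 \<alpha>2] K assms
    by (auto simp: ennreal_mult_less_top power_less_top_ennreal)
  finally show ?thesis .
qed

lemma integrable_jacobi_weight:
  assumes "\<alpha>1 > -1" "\<alpha>2 > -1" "\<alpha> > -1" "\<alpha> > - (1 + \<alpha>1)" "\<alpha> > - (1 + \<alpha>2)" and N: "N > 0"
  shows "integrable (cube_uniform N) (jacobi_weight N (2 * \<alpha> / real N) \<alpha>1 \<alpha>2)"
proof (rule integrableI_nonneg)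
  \<comment> \<open>For \<alpha> < 0 this is the strength of the singularity that a centred factor
    sees; for nonnegative \<alpha> the interaction is bounded and 0 suffices. The three lower bounds
    on \<alpha> become g < 1, g < 1 + \<alpha>1 and g < 1 + \<alpha>2.\<close>
  define g where "g = max 0 (- \<alpha>)"
  have g: "0 \<le> g" "g < 1" "g < 1 + \<alpha>1" "g < 1 + \<alpha>2" "- g \<le> \<alpha>" using assms by (auto simp: g_def)
  let ?V = "\<lambda>x::nat\<Rightarrow>real. \<Prod>l<N. x l powr \<alpha>1 * (1 - x l) powr \<alpha>2"
  let ?W = "\<lambda>k x. ?V x * (\<Prod>j\<in>{..<N}-{k}. \<bar>x k - x j\<bar> powr - g)"
  have "(\<integral>\<^sup>+x. ennreal (jacobi_weight N (2 * \<alpha> / real N) \<alpha>1 \<alpha>2 x) \<partial>cube_uniform N)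
     \<le> (\<integral>\<^sup>+x. (\<Sum>k<N. ennreal (?W k x)) \<partial>cube_uniform N)"
  proof (intro nn_integral_mono_AE)
    show "AE x in cube_uniform N. ennreal (jacobi_weight N (2 * \<alpha> / real N) \<alpha>1 \<alpha>2 x) \<le> (\<Sum>k<N. ennreal (?W k x))"
      using AE_cube_uniform
    proof eventually_elim
      case (elim x)
      then have x: "0 < x k" "x k < 1" if "k < N" for k
        using that by (auto simp: open_unit_cube_def PiE_iff)
      have V: "?V x \<ge> 0" by (intro prod_nonneg) auto
      have "jacobi_weight N (2 * \<alpha> / real N) \<alpha>1 \<alpha>2 x
        \<le> ?V x * (\<Sum>k<N. \<Prod>j\<in>{..<N}-{k}. \<bar>x k - x j\<bar> powr - g)"
        unfolding jacobi_weight_def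
      proof (intro mult_left_mono interaction_le_sum N g V)
        fix k j assume "k < N" "j < N"
        then show "\<bar>x k - x j\<bar> \<le> 1" using x[of k] x[of j] by auto
      qed
      also have "\<dots> = (\<Sum>k<N. ?W k x)" by (simp add: sum_distrib_left)
      finally show ?case
        using V by (subst sum_ennreal) (auto intro!: mult_nonneg_nonneg prod_nonneg ennreal_leI)
    qed
  qed
  also have "\<dots> = (\<Sum>k<N. \<integral>\<^sup>+x. ennreal (?W k x) \<partial>cube_uniform N)"
  proof (rule nn_integral_sum)
    fix k assume "k \<in> {..<N}"
    then show "(\<lambda>x. ennreal (?W k x)) \<in> borel_measurable (cube_uniform N)"
      using measurable_decoupled[of k N] by (simp add: measurable_cube_uniform)
  qed
  also have "\<dots> < \<top>"
    using nn_integral_decoupled_finite[of \<alpha>1 \<alpha>2 g] assms g by simp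
  finally show "(\<integral>\<^sup>+x. ennreal (jacobi_weight N (2 * \<alpha> / real N) \<alpha>1 \<alpha>2 x) \<partial>cube_uniform N) < \<infinity>"
    by simp
qed (auto simp: measurable_cube_uniform)

text \<open>A zero integral would make the nonnegative weight vanish almost everywhere. It is
  nonzero on the box that confines coordinate k to the k-th open subinterval of length 1 / N, where
  coordinates are distinct and interior, and this box has positive mass.\<close>

lemma jacobi_norm_pos:
  assumes "integrable (cube_uniform N) (jacobi_weight N \<beta> \<alpha>1 \<alpha>2)" and N: "N > 0"
  shows "jacobi_norm N \<beta> \<alpha>1 \<alpha>2 > 0"
proof (rule ccontr)
  assume "\<not> jacobi_norm N \<beta> \<alpha>1 \<alpha>2 > 0"
  moreover have "jacobi_norm N \<beta> \<alpha>1 \<alpha>2 \<ge> 0"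
    unfolding jacobi_norm_eq by (intro Bochner_Integration.integral_nonneg) simp
  ultimately have "(LINT x|cube_uniform N. jacobi_weight N \<beta> \<alpha>1 \<alpha>2 x) = 0"
    unfolding jacobi_norm_eq by linarith
  then have AE0: "AE x in cube_uniform N. jacobi_weight N \<beta> \<alpha>1 \<alpha>2 x = 0"
    using assms by (subst (asm) integral_nonneg_eq_0_iff_AE) auto
  interpret U: prob_space unit_uniform by (rule prob_space_unit_uniform)
  interpret P: product_sigma_finite "\<lambda>_::nat. unit_uniform"
    by (simp add: product_sigma_finite_def U.sigma_finite_measure_axioms)
  define S where "S = (\<lambda>k. {real k / real N<..<real (Suc k) / real N})"
  have S01: "S k \<subseteq> {0<..<1}" if "k < N" for k
  proof -
    have *: "real (Suc k) / real N \<le> 1" "0 \<le> real k / real N" using that N by (simp_all add: field_simps)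
    show ?thesis
    proof
      fix x assume "x \<in> S k"
      then have "real k / real N < x" "x < real (Suc k) / real N" by (auto simp: S_def)
      with * show "x \<in> {0<..<1}" unfolding greaterThanLessThan_iff by linarith
    qed
  qed
  have pos: "jacobi_weight N \<beta> \<alpha>1 \<alpha>2 x \<noteq> 0" if x: "x \<in> PiE {..<N} S" for x
  proof -
    have "x k \<noteq> 0" "x k \<noteq> 1" if "k < N" for k using x S01[OF that] that by (fastforce simp: PiE_iff)+
    moreover have "x k - x j \<noteq> 0" if "k < N" "j < k" for j k
    proof -
      have "real (Suc j) / real N \<le> real k / real N" using that by (intro divide_right_mono) auto
      moreover have "x k > real k / real N" "x j < real (Suc j) / real N"
        using x that by (auto simp: PiE_iff S_def)
      ultimately show ?thesis by linarith
    qed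
    ultimately show ?thesis unfolding jacobi_weight_def by (auto simp: prod_zero_iff)
  qed
  have "AE x in cube_uniform N. x \<notin> PiE {..<N} S"
    using AE0 pos by (auto elim: eventually_mono)
  moreover have S: "PiE {..<N} S \<in> sets (cube_uniform N)"
    by (intro sets_PiM_I_finite) (auto simp: S_def)
  moreover have "{x \<in> space (cube_uniform N). \<not> x \<notin> PiE {..<N} S} = PiE {..<N} S"
    using sets.sets_into_space[OF S] by auto
  ultimately have "emeasure (cube_uniform N) (PiE {..<N} S) = 0"
    by (subst (asm) AE_iff_measurable)
  moreover have "emeasure (cube_uniform N) (PiE {..<N} S) = (\<Prod>k<N. emeasure unit_uniform (S k))"
    by (intro P.emeasure_PiM) (auto simp: S_def)
  moreover have "emeasure unit_uniform (S k) \<noteq> 0" if "k < N" for k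
  proof -
    have [measurable]: "S k \<in> sets borel" by (simp add: S_def)
    have "emeasure unit_uniform (S k) = (\<integral>\<^sup>+x. indicator {0<..<1} x * indicator (S k) x \<partial>lborel)"
      by (subst emeasure_density) auto
    also have "\<dots> = (\<integral>\<^sup>+x. indicator (S k) x \<partial>lborel)"
      using S01[OF that] by (intro nn_integral_cong) (auto simp: indicator_def)
    also have "\<dots> = ennreal (1 / real N)"
      using N by (simp add: S_def divide_right_mono flip: diff_divide_distrib)
    finally show ?thesis using N by simp
  qed
  ultimately show False by (simp add: prod_zero_iff)
qed

section \<open>Uniform first-order expansions\<close>

text \<open>This replaces differentiation under the integral sign: a remainder bounded by one
  multiple of t^2 on all of \<open>S\<close> stays of order t^2 after integration against an
  integrable weight. The bounds on the two coefficients make the notion closed under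
  products.\<close>

definition first_order_on :: "'a set \<Rightarrow> (real \<Rightarrow> 'a \<Rightarrow> real) \<Rightarrow> ('a \<Rightarrow> real) \<Rightarrow> ('a \<Rightarrow> real) \<Rightarrow> bool" where
  "first_order_on S F F0 F1 \<longleftrightarrow>
     (\<exists>K\<ge>0. \<exists>\<delta>>0. \<forall>x\<in>S. \<bar>F0 x\<bar> \<le> K \<and> \<bar>F1 x\<bar> \<le> K \<and>
        (\<forall>t\<in>{0<..<\<delta>}. \<bar>F t x - F0 x - t * F1 x\<bar> \<le> K * t\<^sup>2))"

lemma first_order_onE:
  assumes "first_order_on S F F0 F1"
  obtains K \<delta> where "K \<ge> 0" "0 < \<delta>" "\<delta> \<le> 1" "\<And>x. x \<in> S \<Longrightarrow> \<bar>F0 x\<bar> \<le> K" "\<And>x. x \<in> S \<Longrightarrow> \<bar>F1 x\<bar> \<le> K"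
    "\<And>x t. x \<in> S \<Longrightarrow> 0 < t \<Longrightarrow> t < \<delta> \<Longrightarrow> \<bar>F t x - F0 x - t * F1 x\<bar> \<le> K * t\<^sup>2"
proof -
  from assms obtain K \<delta> where *: "K \<ge> 0" "0 < \<delta>" "\<And>x. x \<in> S \<Longrightarrow> \<bar>F0 x\<bar> \<le> K" "\<And>x. x \<in> S \<Longrightarrow> \<bar>F1 x\<bar> \<le> K"
    "\<And>x t. x \<in> S \<Longrightarrow> 0 < t \<Longrightarrow> t < \<delta> \<Longrightarrow> \<bar>F t x - F0 x - t * F1 x\<bar> \<le> K * t\<^sup>2"
    unfolding first_order_on_def by (metis greaterThanLessThan_iff)
  show thesis by (rule that[of K "min \<delta> 1"]) (use * in auto)
qed

lemma first_order_onI: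
  assumes "0 < \<delta>" "\<And>x. x \<in> S \<Longrightarrow> \<bar>F0 x\<bar> \<le> K" "\<And>x. x \<in> S \<Longrightarrow> \<bar>F1 x\<bar> \<le> K"
    "\<And>x t. x \<in> S \<Longrightarrow> 0 < t \<Longrightarrow> t < \<delta> \<Longrightarrow> \<bar>F t x - F0 x - t * F1 x\<bar> \<le> K * t\<^sup>2"
  shows "first_order_on S F F0 F1"
proof -
  have "\<bar>F0 x\<bar> \<le> \<bar>K\<bar>" "\<bar>F1 x\<bar> \<le> \<bar>K\<bar>" if "x \<in> S" for x
    using assms(2,3)[OF that] by auto
  moreover have "\<bar>F t x - F0 x - t * F1 x\<bar> \<le> \<bar>K\<bar> * t\<^sup>2" if "x \<in> S" "0 < t" "t < \<delta>" for x t
  proof -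
    have "K * t\<^sup>2 \<le> \<bar>K\<bar> * t\<^sup>2" by (intro mult_right_mono) auto
    then show ?thesis using assms(4)[OF that] by linarith
  qed
  ultimately show ?thesis unfolding first_order_on_def using \<open>0 < \<delta>\<close>
    by (intro exI[of _ "\<bar>K\<bar>"] exI[of _ \<delta>]) auto
qed

lemma first_order_on_const:
  assumes "\<And>x. x \<in> S \<Longrightarrow> \<bar>f x\<bar> \<le> K"
  shows "first_order_on S (\<lambda>t. f) f (\<lambda>_. 0)"
proof (rule first_order_onI[of 1 _ _ "\<bar>K\<bar>"])
  show "\<bar>f x\<bar> \<le> \<bar>K\<bar>" if "x \<in> S" for x using assms[OF that] by linarith
qed auto

lemma first_order_on_linear:
  assumes "\<And>x. x \<in> S \<Longrightarrow> \<bar>h x\<bar> \<le> K"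
  shows "first_order_on S (\<lambda>t x. 1 + t * h x) (\<lambda>_. 1) h"
proof (rule first_order_onI[of 1 _ _ "max K 1"])
  show "\<bar>h x\<bar> \<le> max K 1" if "x \<in> S" for x using assms[OF that] by linarith
qed auto

lemma first_order_on_add:
  assumes "first_order_on S F F0 F1" "first_order_on S G G0 G1"
  shows "first_order_on S (\<lambda>t x. F t x + G t x) (\<lambda>x. F0 x + G0 x) (\<lambda>x. F1 x + G1 x)"
proof -
  obtain K d where F: "K \<ge> 0" "0 < d" "d \<le> 1" "\<And>x. x \<in> S \<Longrightarrow> \<bar>F0 x\<bar> \<le> K" "\<And>x. x \<in> S \<Longrightarrow> \<bar>F1 x\<bar> \<le> K"
    "\<And>x t. x \<in> S \<Longrightarrow> 0 < t \<Longrightarrow> t < d \<Longrightarrow> \<bar>F t x - F0 x - t * F1 x\<bar> \<le> K * t\<^sup>2"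
    using first_order_onE[OF assms(1)] by blast
  obtain L e where G: "L \<ge> 0" "0 < e" "e \<le> 1" "\<And>x. x \<in> S \<Longrightarrow> \<bar>G0 x\<bar> \<le> L" "\<And>x. x \<in> S \<Longrightarrow> \<bar>G1 x\<bar> \<le> L"
    "\<And>x t. x \<in> S \<Longrightarrow> 0 < t \<Longrightarrow> t < e \<Longrightarrow> \<bar>G t x - G0 x - t * G1 x\<bar> \<le> L * t\<^sup>2"
    using first_order_onE[OF assms(2)] by blast
  show ?thesis
  proof (rule first_order_onI[of "min d e" _ _ "K + L"])
    fix x assume x: "x \<in> S"
    show "\<bar>F0 x + G0 x\<bar> \<le> K + L" "\<bar>F1 x + G1 x\<bar> \<le> K + L" using F(4,5)[OF x] G(4,5)[OF x] by linarith+
    fix t assume t: "0 < t" "t < min d e"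
    then have "t < d" "t < e" by auto
    then show "\<bar>F t x + G t x - (F0 x + G0 x) - t * (F1 x + G1 x)\<bar> \<le> (K + L) * t\<^sup>2"
      using F(6)[OF x t(1)] G(6)[OF x t(1)] unfolding distrib_left distrib_right by linarith
  qed (use F G in auto)
qed

lemma first_order_on_mult:
  assumes "first_order_on S F F0 F1" "first_order_on S G G0 G1"
  shows "first_order_on S (\<lambda>t x. F t x * G t x) (\<lambda>x. F0 x * G0 x) (\<lambda>x. F1 x * G0 x + F0 x * G1 x)"
proof -
  obtain K d where F: "K \<ge> 0" "0 < d" "d \<le> 1" "\<And>x. x \<in> S \<Longrightarrow> \<bar>F0 x\<bar> \<le> K" "\<And>x. x \<in> S \<Longrightarrow> \<bar>F1 x\<bar> \<le> K"
    "\<And>x t. x \<in> S \<Longrightarrow> 0 < t \<Longrightarrow> t < d \<Longrightarrow> \<bar>F t x - F0 x - t * F1 x\<bar> \<le> K * t\<^sup>2"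
    using first_order_onE[OF assms(1)] by blast
  obtain L e where G: "L \<ge> 0" "0 < e" "e \<le> 1" "\<And>x. x \<in> S \<Longrightarrow> \<bar>G0 x\<bar> \<le> L" "\<And>x. x \<in> S \<Longrightarrow> \<bar>G1 x\<bar> \<le> L"
    "\<And>x t. x \<in> S \<Longrightarrow> 0 < t \<Longrightarrow> t < e \<Longrightarrow> \<bar>G t x - G0 x - t * G1 x\<bar> \<le> L * t\<^sup>2"
    using first_order_onE[OF assms(2)] by blast
  show ?thesis
  \<comment> \<open>The constant is 1 + 3 + 2: the product of the linear terms, the bound 3 L on G
    at t, and the bound 2 K on the linear part of F, all for t at most 1.\<close>
  proof (rule first_order_onI[of "min d e" _ _ "6 * (K * L)"])
    fix x assume x: "x \<in> S"
    note b = F(4,5)[OF x] G(4,5)[OF x]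
    have KL: "K * L \<ge> 0" using F G by simp
    have "\<bar>F0 x * G0 x\<bar> \<le> K * L" "\<bar>F1 x * G0 x\<bar> \<le> K * L" "\<bar>F0 x * G1 x\<bar> \<le> K * L"
      unfolding abs_mult using b F(1) G(1) by (auto intro!: mult_mono)
    then show "\<bar>F0 x * G0 x\<bar> \<le> 6 * (K * L)" "\<bar>F1 x * G0 x + F0 x * G1 x\<bar> \<le> 6 * (K * L)"
      using KL by linarith+
    fix t assume t: "0 < t" "t < min d e"
    define r s where "r = F t x - F0 x - t * F1 x" and "s = G t x - G0 x - t * G1 x"
    have rs: "\<bar>r\<bar> \<le> K * t\<^sup>2" "\<bar>s\<bar> \<le> L * t\<^sup>2"
      using F(6)[OF x, of t] G(6)[OF x, of t] t by (auto simp: r_def s_def)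
    have t1: "t \<le> 1" "t\<^sup>2 \<le> 1" using t F(3) by (auto simp: power2_eq_square intro: mult_le_one)
    have "\<bar>t * G1 x\<bar> \<le> 1 * L" "\<bar>t * F1 x\<bar> \<le> 1 * K"
      unfolding abs_mult using t t1 b F(1) G(1) by (intro mult_mono; simp)+
    moreover have "\<bar>s\<bar> \<le> L" using rs(2) mult_left_le[OF t1(2) G(1)] by linarith
    ultimately have Gt: "\<bar>G t x\<bar> \<le> 3 * L" and Ft: "\<bar>F0 x + t * F1 x\<bar> \<le> 2 * K"
      using b unfolding s_def by linarith+
    have "F t x * G t x - F0 x * G0 x - t * (F1 x * G0 x + F0 x * G1 x)
      = t\<^sup>2 * (F1 x * G1 x) + r * G t x + (F0 x + t * F1 x) * s"
      unfolding r_def s_def by (simp add: algebra_simps power2_eq_square)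
    also have "\<bar>\<dots>\<bar> \<le> t\<^sup>2 * (K * L) + (K * t\<^sup>2) * (3 * L) + (2 * K) * (L * t\<^sup>2)"
    proof -
      have "\<bar>t\<^sup>2 * (F1 x * G1 x)\<bar> \<le> t\<^sup>2 * (K * L)"
        unfolding abs_mult using b F G by (auto intro!: mult_mono)
      moreover have "\<bar>r * G t x\<bar> \<le> (K * t\<^sup>2) * (3 * L)"
        unfolding abs_mult using rs Gt F by (intro mult_mono) auto
      moreover have "\<bar>(F0 x + t * F1 x) * s\<bar> \<le> (2 * K) * (L * t\<^sup>2)"
        unfolding abs_mult using rs Ft F by (intro mult_mono) auto
      ultimately show ?thesis by linarith
    qed
    also have "\<dots> = 6 * (K * L) * t\<^sup>2" by simp
    finally show "\<bar>F t x * G t x - F0 x * G0 x - t * (F1 x * G0 x + F0 x * G1 x)\<bar> \<le> 6 * (K * L) * t\<^sup>2" .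
  qed (use F G in auto)
qed

lemma first_order_on_sum:
  assumes "\<And>i. i \<in> I \<Longrightarrow> first_order_on S (F i) (F0 i) (F1 i)"
  shows "first_order_on S (\<lambda>t x. \<Sum>i\<in>I. F i t x) (\<lambda>x. \<Sum>i\<in>I. F0 i x) (\<lambda>x. \<Sum>i\<in>I. F1 i x)"
  using assms
proof (induction I rule: infinite_finite_induct)
  case (insert i I)
  then show ?case using first_order_on_add[of S "F i" "F0 i" "F1 i"] by simp
qed (use first_order_on_const[of S "\<lambda>_. 0" 0] in auto)

lemma first_order_on_prod:
  assumes "\<And>i. i \<in> I \<Longrightarrow> first_order_on S (F i) (\<lambda>_. 1) (F1 i)"
  shows "first_order_on S (\<lambda>t x. \<Prod>i\<in>I. F i t x) (\<lambda>_. 1) (\<lambda>x. \<Sum>i\<in>I. F1 i x)"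
  using assms
proof (induction I rule: infinite_finite_induct)
  case (insert i I)
  then show ?case
    using first_order_on_mult[of S "F i" "\<lambda>_. 1" "F1 i" "\<lambda>t x. \<Prod>i\<in>I. F i t x" "\<lambda>_. 1" "\<lambda>x. \<Sum>i\<in>I. F1 i x"]
    by simp
qed (use first_order_on_const[of S "\<lambda>_. 1" 1] in auto)

lemma first_order_on_power:
  assumes "first_order_on S F (\<lambda>_. 1) F1"
  shows "first_order_on S (\<lambda>t x. F t x ^ n) (\<lambda>_. 1) (\<lambda>x. real n * F1 x)"
  using first_order_on_prod[of "{..<n}" S "\<lambda>_. F" "\<lambda>_. F1"] assms by simp

text \<open>Near t = 0 the values of F are uniformly close to 1, so the expansion of (1 + u) powr a
  at the single point u = 0 gives a uniform one.\<close>

lemma first_order_on_powr: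
  assumes "first_order_on S F (\<lambda>_. 1) F1"
  shows "first_order_on S (\<lambda>t x. F t x powr a) (\<lambda>_. 1) (\<lambda>x. a * F1 x)"
proof -
  obtain K d where F: "K \<ge> 0" "0 < d" "d \<le> 1" "\<And>x. x \<in> S \<Longrightarrow> \<bar>F1 x\<bar> \<le> K"
    "\<And>x t. x \<in> S \<Longrightarrow> 0 < t \<Longrightarrow> t < d \<Longrightarrow> \<bar>F t x - 1 - t * F1 x\<bar> \<le> K * t\<^sup>2"
    using first_order_onE[OF assms] by metis
  have "(\<lambda>u. (1 + u) powr a - 1 - a * u) \<in> O[at 0](\<lambda>u::real. u\<^sup>2)"
    by real_asymp
  then obtain C where "eventually (\<lambda>u. norm ((1 + u) powr a - 1 - a * u) \<le> C * norm (u\<^sup>2)) (at 0)"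
    by (elim landau_o.bigE)
  then obtain e where "e > 0" and C: "\<And>u. u \<noteq> 0 \<Longrightarrow> \<bar>u\<bar> < e \<Longrightarrow> \<bar>(1 + u) powr a - 1 - a * u\<bar> \<le> C * u\<^sup>2"
    by (auto simp: eventually_at dist_real_def)
  then have Ce: "\<bar>(1 + u) powr a - 1 - a * u\<bar> \<le> \<bar>C\<bar> * u\<^sup>2" if "\<bar>u\<bar> < e" for u
  proof (cases "u = 0")
    case False
    have "C * u\<^sup>2 \<le> \<bar>C\<bar> * u\<^sup>2" by (intro mult_right_mono) auto
    with C[OF False that] show ?thesis by linarith
  qed simp
  show ?thesis
  \<comment> \<open>The deviation u of F from 1 is at most 2 K t, which this range of t keeps below
    \<open>e\<close>; the summand 1 guards against K = 0. The \<open>max 1\<close> accounts for the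
    leading coefficient 1.\<close>
  proof (rule first_order_onI[of "min d (e / (2 * K + 1))" _ _ "max 1 (\<bar>a\<bar> * K + \<bar>C\<bar> * (2 * K)\<^sup>2)"])
    have aK: "0 \<le> \<bar>C\<bar> * (2 * K)\<^sup>2" by simp
    fix x assume x: "x \<in> S"
    show "\<bar>a * F1 x\<bar> \<le> max 1 (\<bar>a\<bar> * K + \<bar>C\<bar> * (2 * K)\<^sup>2)"
      using mult_left_mono[OF F(4)[OF x], of "\<bar>a\<bar>"] aK unfolding abs_mult by linarith
    fix t assume t: "0 < t" "t < min d (e / (2 * K + 1))"
    define u where "u = F t x - 1"
    have r: "\<bar>u - t * F1 x\<bar> \<le> K * t\<^sup>2" using F(5)[OF x, of t] t by (simp add: u_def)
    have "K * t\<^sup>2 \<le> K * t" using t F by (intro mult_left_mono) (auto simp: power2_eq_square)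
    moreover have "\<bar>t * F1 x\<bar> \<le> K * t"
      using mult_left_mono[OF F(4)[OF x], of t] t by (simp add: abs_mult mult.commute)
    ultimately have u: "\<bar>u\<bar> \<le> 2 * K * t" using r by linarith
    also have "2 * K * t < e"
      using t F by (simp add: field_simps)
    finally have "\<bar>(1 + u) powr a - 1 - a * u\<bar> \<le> \<bar>C\<bar> * u\<^sup>2" by (rule Ce)
    also have "\<dots> \<le> \<bar>C\<bar> * (2 * K * t)\<^sup>2"
      using u by (intro mult_left_mono power2_le_iff_abs_le[THEN iffD2]) auto
    finally have 1: "\<bar>(1 + u) powr a - 1 - a * u\<bar> \<le> (\<bar>C\<bar> * (2 * K)\<^sup>2) * t\<^sup>2"
      by (simp add: power_mult_distrib)
    have "\<bar>a * u - t * (a * F1 x)\<bar> = \<bar>a\<bar> * \<bar>u - t * F1 x\<bar>"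
      by (simp add: abs_mult[symmetric] algebra_simps)
    also have "\<dots> \<le> (\<bar>a\<bar> * K) * t\<^sup>2"
      using mult_left_mono[OF r, of "\<bar>a\<bar>"] by simp
    finally have "\<bar>F t x powr a - 1 - t * (a * F1 x)\<bar> \<le> (\<bar>a\<bar> * K + \<bar>C\<bar> * (2 * K)\<^sup>2) * t\<^sup>2"
      using 1 unfolding distrib_right u_def by simp
    also have "\<dots> \<le> max 1 (\<bar>a\<bar> * K + \<bar>C\<bar> * (2 * K)\<^sup>2) * t\<^sup>2"
      by (intro mult_right_mono) auto
    finally show "\<bar>F t x powr a - 1 - t * (a * F1 x)\<bar> \<le> max 1 (\<bar>a\<bar> * K + \<bar>C\<bar> * (2 * K)\<^sup>2) * t\<^sup>2" .
  qed (use F \<open>e > 0\<close> in auto)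
qed

text \<open>If the integral does not depend on t, its linear term equals minus the integrated
  remainder. Dividing by t bounds the coefficient by K Z t, with Z the total weight, and t tends to
  0 from the right.\<close>

lemma first_order_integral_zero:
  assumes w: "integrable M w" "\<And>x. w x \<ge> 0" and S: "AE x in M. x \<in> S"
    and fo: "first_order_on S G G0 G1"
    and meas: "\<And>t. G t \<in> borel_measurable M" "G0 \<in> borel_measurable M" "G1 \<in> borel_measurable M"
    and const: "0 < \<eta>" "\<And>t. 0 < t \<Longrightarrow> t < \<eta> \<Longrightarrow> (LINT x|M. w x * G t x) = (LINT x|M. w x * G0 x)"
  shows "(LINT x|M. w x * G1 x) = 0"
proof -
  have bdd: "integrable M (\<lambda>x. w x * g x)"
    if "g \<in> borel_measurable M" "\<And>x. x \<in> S \<Longrightarrow> \<bar>g x\<bar> \<le> B" for g B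
  proof (rule Bochner_Integration.integrable_bound)
    show "integrable M (\<lambda>x. B * w x)" using w by simp
    show "(\<lambda>x. w x * g x) \<in> borel_measurable M" using that w by measurable
    show "AE x in M. norm (w x * g x) \<le> norm (B * w x)"
      using S
    proof eventually_elim
      case (elim x)
      have "\<bar>g x\<bar> * w x \<le> \<bar>B\<bar> * w x"
        using that(2)[OF elim] w by (intro mult_right_mono) auto
      then show ?case using w by (simp add: abs_mult mult.commute)
    qed
  qed
  obtain K d where F: "K \<ge> 0" "0 < d" "d \<le> 1" "\<And>x. x \<in> S \<Longrightarrow> \<bar>G0 x\<bar> \<le> K" "\<And>x. x \<in> S \<Longrightarrow> \<bar>G1 x\<bar> \<le> K"
    "\<And>x t. x \<in> S \<Longrightarrow> 0 < t \<Longrightarrow> t < d \<Longrightarrow> \<bar>G t x - G0 x - t * G1 x\<bar> \<le> K * t\<^sup>2"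
    using first_order_onE[OF fo] by blast
  define I Z where "I = (LINT x|M. w x * G1 x)" and "Z = (LINT x|M. w x)"
  note int = bdd[OF meas(2) F(4)] bdd[OF meas(3) F(5)]
  have I: "\<bar>I\<bar> \<le> K * Z * t" if t: "0 < t" "t < min d \<eta>" for t
  proof -
    have gb: "\<bar>G t x - G0 x - t * G1 x\<bar> \<le> K * t\<^sup>2" if "x \<in> S" for x using F(6)[OF that] t by auto
    have m: "(\<lambda>x. G t x - G0 x - t * G1 x) \<in> borel_measurable M" using meas by measurable
    note ir = bdd[OF m gb]
    have eq: "w x * G t x = w x * (G t x - G0 x - t * G1 x) + w x * G0 x + t * (w x * G1 x)" for x
      by (simp add: algebra_simps)
    have "(LINT x|M. w x * G t x)
      = (LINT x|M. w x * (G t x - G0 x - t * G1 x)) + (LINT x|M. w x * G0 x) + t * I"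
      unfolding I_def using int ir by (subst eq, simp)
    then have "t * I = - (LINT x|M. w x * (G t x - G0 x - t * G1 x))"
      using const(2)[of t] t by simp
    then have "t * \<bar>I\<bar> = \<bar>LINT x|M. w x * (G t x - G0 x - t * G1 x)\<bar>"
      using t by (metis abs_minus_cancel abs_mult abs_of_pos)
    also have "\<dots> \<le> (LINT x|M. \<bar>w x * (G t x - G0 x - t * G1 x)\<bar>)"
      by (rule integral_abs_bound)
    also have "\<dots> \<le> (LINT x|M. K * t\<^sup>2 * w x)"
    proof (intro integral_mono_AE)
      show "AE x in M. \<bar>w x * (G t x - G0 x - t * G1 x)\<bar> \<le> K * t\<^sup>2 * w x"
        using S
      proof eventually_elim
        case (elim x)
        have "w x * \<bar>G t x - G0 x - t * G1 x\<bar> \<le> w x * (K * t\<^sup>2)"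
          using gb[OF elim] w by (intro mult_left_mono) auto
        then show ?case using w by (simp add: abs_mult mult_ac)
      qed
    qed (use w ir in auto)
    also have "\<dots> = t * (K * Z * t)" by (simp add: Z_def power2_eq_square)
    finally show ?thesis using t by simp
  qed
  have "((\<lambda>t. K * Z * t) \<longlongrightarrow> K * Z * 0) (at_right 0)" by (intro tendsto_intros)
  moreover have "eventually (\<lambda>t. \<bar>I\<bar> \<le> K * Z * t) (at_right 0)"
    unfolding eventually_at_right_field using I F(2) const(1) by (intro exI[of _ "min d \<eta>"]) auto
  ultimately have "\<bar>I\<bar> \<le> K * Z * 0"
    by (intro tendsto_lowerbound[where F="at_right (0::real)"]) auto
  then show ?thesis by (simp add: I_def)
qed

section \<open>The loop equation with respect to the weight\<close>

text \<open>The flow \<open>\<phi>\<^sub>t(y) = y + t (y - y^(p+1))\<close>, acting on every coordinate, preserves the open cube, and the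
  pulled-back weight is the weight times a positive factor that is smooth in \<open>t\<close>. Integration by parts
  would instead meet \<open>\<bar>x\<^sub>k - x\<^sub>j\<bar>\<close> to the power \<open>\<beta> - 1\<close>, which is not integrable for \<open>\<beta> < 0\<close>.\<close>

definition loop_flow :: "nat \<Rightarrow> real \<Rightarrow> real \<Rightarrow> real" where
  "loop_flow p t y = y + t * (y - y ^ Suc p)"

text \<open>The divided difference of the field y - y^(p+1) at y and z; on the diagonal it becomes
  the derivative 1 - (p + 1) y^p.\<close>

definition pair_quotient :: "nat \<Rightarrow> real \<Rightarrow> real \<Rightarrow> real" where
  "pair_quotient p y z = 1 - (\<Sum>a\<le>p. y ^ a * z ^ (p - a))"

lemma loop_flow_factor: "loop_flow p t y = y * (1 + t * (1 - y ^ p))"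
  by (simp add: loop_flow_def algebra_simps)

text \<open>The field is 1 - y times the geometric sum y + ... + y^p. This sum is the origin of the
  sums multiplied by \<alpha>2 in both recursions.\<close>

lemma loop_flow_factor': "1 - loop_flow p t y = (1 - y) * (1 + t * - (\<Sum>s=1..p. y ^ s))"
proof -
  have "(1 - y) * (\<Sum>s=1..p. y ^ s) = y - y ^ Suc p"
  proof (induction p)
    case (Suc p)
    have "(1 - y) * (\<Sum>s=1..Suc p. y ^ s) = (1 - y) * (\<Sum>s=1..p. y ^ s) + (1 - y) * y ^ Suc p"
      by (simp add: distrib_left)
    also have "\<dots> = y - y ^ Suc (Suc p)"
      unfolding Suc by (simp add: algebra_simps)
    finally show ?case .
  qed simp
  moreover have "1 - loop_flow p t y = (1 - y) - t * (y - y ^ Suc p)"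
    by (simp add: loop_flow_def)
  ultimately have "1 - loop_flow p t y = (1 - y) - t * ((1 - y) * (\<Sum>s=1..p. y ^ s))" by (simp only:)
  then show ?thesis by (simp add: algebra_simps)
qed

lemma loop_flow_diff: "loop_flow p t y - loop_flow p t z = (y - z) * (1 + t * pair_quotient p y z)"
proof -
  have "y ^ Suc p - z ^ Suc p = (y - z) * (\<Sum>a\<le>p. y ^ a * z ^ (p - a))"
    using diff_power_eq_sum[of y p z] by (simp add: lessThan_Suc_atMost)
  moreover have "loop_flow p t y - loop_flow p t z = (y - z) + t * ((y - z) - (y ^ Suc p - z ^ Suc p))"
    by (simp add: loop_flow_def algebra_simps)
  ultimately have "loop_flow p t y - loop_flow p t z
      = (y - z) + t * ((y - z) - (y - z) * (\<Sum>a\<le>p. y ^ a * z ^ (p - a)))" by (simp only:)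
  then show ?thesis by (simp add: pair_quotient_def algebra_simps)
qed

lemma pair_quotient_sym: "pair_quotient p y z = pair_quotient p z y"
  unfolding pair_quotient_def
  by (intro arg_cong2[where f="(-)"] refl sum.reindex_bij_witness[of _ "\<lambda>a. p - a" "\<lambda>a. p - a"]) auto

lemma pair_quotient_bounds:
  assumes "0 \<le> y" "y \<le> 1" "0 \<le> z" "z \<le> 1"
  shows "- real p \<le> pair_quotient p y z" "pair_quotient p y z \<le> 1"
proof -
  have "(\<Sum>a\<le>p. y ^ a * z ^ (p - a)) \<le> (\<Sum>a\<le>p. 1)"
    using assms by (intro sum_mono mult_le_one) (auto intro: power_le_one)
  then show "- real p \<le> pair_quotient p y z" by (simp add: pair_quotient_def)
  have "(\<Sum>a\<le>p. y ^ a * z ^ (p - a)) \<ge> 0"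
    using assms by (intro sum_nonneg) auto
  then show "pair_quotient p y z \<le> 1" by (simp add: pair_quotient_def)
qed

lemma sum_power_bounds:
  fixes y :: real
  assumes "0 \<le> y" "y \<le> 1"
  shows "0 \<le> (\<Sum>s=1..p. y ^ s)" "(\<Sum>s=1..p. y ^ s) \<le> real p"
proof -
  have "(\<Sum>s=1..p. y ^ s) \<le> (\<Sum>s=1..p. 1)"
    using assms by (intro sum_mono power_le_one) auto
  then show "(\<Sum>s=1..p. y ^ s) \<le> real p" by simp
qed (use assms in \<open>auto intro!: sum_nonneg\<close>)

text \<open>The number - p is a lower bound for every first-order coefficient in use: those of the
  two endpoint factors, of the pair factor and of the Jacobian. One range of t therefore keeps all
  of them positive.\<close>

lemma one_plus_pos:
  fixes t h :: real
  assumes "0 < t" "t < 1 / (real p + 1)" "- real p \<le> h"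
  shows "0 < 1 + t * h"
proof -
  have "t * real p < 1" using assms(1,2) by (simp add: field_simps)
  moreover have "t * - real p \<le> t * h" using assms by (intro mult_left_mono) auto
  ultimately show ?thesis by simp
qed

lemma loop_flow_in_unit:
  assumes "0 < t" "t < 1 / (real p + 1)" "y \<in> {0<..<1}"
  shows "loop_flow p t y \<in> {0<..<1}"
proof -
  have y: "0 \<le> y" "y \<le> 1" using assms by auto
  have "0 < 1 + t * (1 - y ^ p)" "0 < 1 + t * - (\<Sum>s=1..p. y ^ s)"
    by (rule one_plus_pos[OF assms(1,2)], use power_le_one[OF y, of p] sum_power_bounds[OF y, of p] in simp)+
  then have "loop_flow p t y > 0" "1 - loop_flow p t y > 0"
    using assms(3) unfolding loop_flow_factor' unfolding loop_flow_factor by auto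
  then show ?thesis by simp
qed

text \<open>Jacobian times pulled-back weight divided by weight, with the powers of x, 1 - x and of
  the distances already cancelled. The third one-body factor is the derivative of
  \<open>loop_flow\<close>.\<close>

definition weight_ratio :: "nat \<Rightarrow> real \<Rightarrow> real \<Rightarrow> real \<Rightarrow> nat \<Rightarrow> real \<Rightarrow> (nat \<Rightarrow> real) \<Rightarrow> real" where
  "weight_ratio N \<beta> \<alpha>1 \<alpha>2 p t x =
     (\<Prod>l<N. (1 + t * (1 - x l ^ p)) powr \<alpha>1 * (1 + t * - (\<Sum>s=1..p. x l ^ s)) powr \<alpha>2 *
              (1 + t * (1 - (real p + 1) * x l ^ p))) *
     (\<Prod>k<N. \<Prod>j<k. (1 + t * pair_quotient p (x k) (x j)) powr \<beta>)"

lemma jacobi_weight_flow: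
  assumes t: "0 < t" "t < 1 / (real p + 1)" and x: "x \<in> open_unit_cube N"
  shows "(\<Prod>l<N. 1 + t * (1 - (real p + 1) * x l ^ p)) *
      jacobi_weight N \<beta> \<alpha>1 \<alpha>2 (compose {..<N} (loop_flow p t) x) =
    jacobi_weight N \<beta> \<alpha>1 \<alpha>2 x * weight_ratio N \<beta> \<alpha>1 \<alpha>2 p t x"
proof -
  let ?\<phi> = "loop_flow p t"
  have x01: "0 \<le> x l" "x l \<le> 1" if "l < N" for l
    using x that by (auto simp: open_unit_cube_def PiE_iff less_imp_le)
  have pos: "0 < 1 + t * (1 - x l ^ p)" "0 < 1 + t * - (\<Sum>s=1..p. x l ^ s)" if "l < N" for l
    by (rule one_plus_pos[OF t], use power_le_one[OF x01[OF that], of p] sum_power_bounds[OF x01[OF that], of p] in simp)+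
  have one: "?\<phi> (x l) powr \<alpha>1 * (1 - ?\<phi> (x l)) powr \<alpha>2 = (x l powr \<alpha>1 * (1 - x l) powr \<alpha>2) *
      ((1 + t * (1 - x l ^ p)) powr \<alpha>1 * (1 + t * - (\<Sum>s=1..p. x l ^ s)) powr \<alpha>2)" if "l < N" for l
    unfolding loop_flow_factor' unfolding loop_flow_factor
    using pos[OF that] x01[OF that] by (subst (1 2) powr_mult) auto
  have two: "\<bar>?\<phi> (x k) - ?\<phi> (x j)\<bar> powr \<beta> =
      \<bar>x k - x j\<bar> powr \<beta> * (1 + t * pair_quotient p (x k) (x j)) powr \<beta>" if "k < N" "j < k" for k j
  proof -
    have "0 < 1 + t * pair_quotient p (x k) (x j)"
      using one_plus_pos[OF t pair_quotient_bounds(1)] x01 that by auto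
    then show ?thesis unfolding loop_flow_diff abs_mult by (subst powr_mult) auto
  qed
  have "jacobi_weight N \<beta> \<alpha>1 \<alpha>2 (compose {..<N} ?\<phi> x) =
     (\<Prod>l<N. ?\<phi> (x l) powr \<alpha>1 * (1 - ?\<phi> (x l)) powr \<alpha>2) *
     (\<Prod>k<N. \<Prod>j<k. \<bar>?\<phi> (x k) - ?\<phi> (x j)\<bar> powr \<beta>)"
    unfolding jacobi_weight_def
    by (intro arg_cong2[where f="(*)"] prod.cong) (auto simp: compose_def)
  also have "(\<Prod>l<N. ?\<phi> (x l) powr \<alpha>1 * (1 - ?\<phi> (x l)) powr \<alpha>2) =
     (\<Prod>l<N. (x l powr \<alpha>1 * (1 - x l) powr \<alpha>2) *
      ((1 + t * (1 - x l ^ p)) powr \<alpha>1 * (1 + t * - (\<Sum>s=1..p. x l ^ s)) powr \<alpha>2))"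
    by (intro prod.cong refl one) simp
  also have "(\<Prod>k<N. \<Prod>j<k. \<bar>?\<phi> (x k) - ?\<phi> (x j)\<bar> powr \<beta>) =
     (\<Prod>k<N. \<Prod>j<k. \<bar>x k - x j\<bar> powr \<beta> * (1 + t * pair_quotient p (x k) (x j)) powr \<beta>)"
    by (intro prod.cong refl two) simp_all
  finally show ?thesis
    unfolding jacobi_weight_def weight_ratio_def by (simp add: prod.distrib mult_ac)
qed

lemma open_unit_cubeD:
  assumes "x \<in> open_unit_cube N" "l < N"
  shows "0 \<le> x l" "x l \<le> 1"
  using assms by (auto simp: open_unit_cube_def PiE_iff less_imp_le)

lemma abs_one_minus_power_le:
  assumes "x \<in> open_unit_cube N" "l < N"
  shows "\<bar>1 - x l ^ p\<bar> \<le> 1"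
proof -
  have "0 \<le> x l ^ p" "x l ^ p \<le> 1" using open_unit_cubeD[OF assms] by (auto intro: power_le_one)
  then show ?thesis by linarith
qed

text \<open>All factors equal 1 at t = 0, so the first-order coefficient of the product is the sum
  of theirs: a logarithmic derivative.\<close>

lemma first_order_weight_ratio:
  "first_order_on (open_unit_cube N) (weight_ratio N \<beta> \<alpha>1 \<alpha>2 p) (\<lambda>_. 1)
     (\<lambda>x. (\<Sum>l<N. \<alpha>1 * (1 - x l ^ p) - \<alpha>2 * (\<Sum>s=1..p. x l ^ s) + (1 - (real p + 1) * x l ^ p)) +
          \<beta> * (\<Sum>k<N. \<Sum>j<k. pair_quotient p (x k) (x j)))"
proof -
  let ?S = "open_unit_cube N"
  have A: "first_order_on ?S (\<lambda>t x. (1 + t * (1 - x l ^ p)) powr \<alpha>1) (\<lambda>_. 1) (\<lambda>x. \<alpha>1 * (1 - x l ^ p))" if "l < N" for l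
    using that by (intro first_order_on_powr first_order_on_linear[of _ _ 1] abs_one_minus_power_le)
  have B: "first_order_on ?S (\<lambda>t x. (1 + t * - (\<Sum>s=1..p. x l ^ s)) powr \<alpha>2) (\<lambda>_. 1)
     (\<lambda>x. \<alpha>2 * - (\<Sum>s=1..p. x l ^ s))" if "l < N" for l
  proof (intro first_order_on_powr first_order_on_linear[of _ _ "real p"])
    fix x assume "x \<in> ?S"
    then show "\<bar>- (\<Sum>s=1..p. x l ^ s)\<bar> \<le> real p"
      using sum_power_bounds[OF open_unit_cubeD[of x N l], of p] that by auto
  qed
  have C: "first_order_on ?S (\<lambda>t x. 1 + t * (1 - (real p + 1) * x l ^ p)) (\<lambda>_. 1)
     (\<lambda>x. 1 - (real p + 1) * x l ^ p)" if "l < N" for l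
  proof (intro first_order_on_linear[of _ _ "1 + (real p + 1)"])
    fix x assume "x \<in> ?S"
    then have "0 \<le> x l ^ p" "x l ^ p \<le> 1" using power_le_one open_unit_cubeD[of x N l] that by auto
    then have "0 \<le> (real p + 1) * x l ^ p" "(real p + 1) * x l ^ p \<le> (real p + 1) * 1"
      by (auto intro!: mult_left_mono)
    moreover have "\<bar>1 - c\<bar> \<le> 1 + b" if "0 \<le> c" "c \<le> b * 1" for b c :: real using that by linarith
    ultimately show "\<bar>1 - (real p + 1) * x l ^ p\<bar> \<le> 1 + (real p + 1)" by blast
  qed
  have D: "first_order_on ?S (\<lambda>t x. (1 + t * pair_quotient p (x k) (x j)) powr \<beta>) (\<lambda>_. 1)
     (\<lambda>x. \<beta> * pair_quotient p (x k) (x j))" if "k < N" "j < N" for k j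
  proof (intro first_order_on_powr first_order_on_linear[of _ _ "1 + real p"])
    fix x assume "x \<in> ?S"
    then show "\<bar>pair_quotient p (x k) (x j)\<bar> \<le> 1 + real p"
      using pair_quotient_bounds[of "x k" "x j" p] open_unit_cubeD[of x N] that by force
  qed
  have ABC: "first_order_on ?S (\<lambda>t x. (1 + t * (1 - x l ^ p)) powr \<alpha>1 * (1 + t * - (\<Sum>s=1..p. x l ^ s)) powr \<alpha>2 *
      (1 + t * (1 - (real p + 1) * x l ^ p))) (\<lambda>_. 1)
    (\<lambda>x. \<alpha>1 * (1 - x l ^ p) - \<alpha>2 * (\<Sum>s=1..p. x l ^ s) + (1 - (real p + 1) * x l ^ p))" if "l < N" for l
    using first_order_on_mult[OF first_order_on_mult[OF A[OF that] B[OF that]] C[OF that]] by simp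
  have "first_order_on ?S (\<lambda>t x. \<Prod>k<N. \<Prod>j<k. (1 + t * pair_quotient p (x k) (x j)) powr \<beta>) (\<lambda>_. 1)
     (\<lambda>x. \<Sum>k<N. \<Sum>j<k. \<beta> * pair_quotient p (x k) (x j))"
    by (intro first_order_on_prod D) auto
  moreover have "first_order_on ?S (\<lambda>t x. \<Prod>l<N. (1 + t * (1 - x l ^ p)) powr \<alpha>1 *
      (1 + t * - (\<Sum>s=1..p. x l ^ s)) powr \<alpha>2 * (1 + t * (1 - (real p + 1) * x l ^ p))) (\<lambda>_. 1)
    (\<lambda>x. \<Sum>l<N. \<alpha>1 * (1 - x l ^ p) - \<alpha>2 * (\<Sum>s=1..p. x l ^ s) + (1 - (real p + 1) * x l ^ p))"
    by (intro first_order_on_prod ABC) auto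
  ultimately show ?thesis
    using first_order_on_mult unfolding weight_ratio_def by (fastforce simp: sum_distrib_left)
qed

lemma power_sum_measurable [measurable]:
  "power_sum N p \<in> borel_measurable (PiM {..<N} (\<lambda>_. borel))"
  unfolding power_sum_def by (intro borel_measurable_sum borel_measurable_power) auto

lemma power_sum_bounds:
  assumes "x \<in> open_unit_cube N"
  shows "\<bar>power_sum N p x\<bar> \<le> real N"
proof -
  have "power_sum N p x \<le> (\<Sum>l<N. 1)"
    unfolding power_sum_def using open_unit_cubeD[OF assms] by (intro sum_mono power_le_one) auto
  moreover have "0 \<le> power_sum N p x"
    unfolding power_sum_def using open_unit_cubeD[OF assms] by (intro sum_nonneg) auto
  ultimately show ?thesis by simp
qed

text \<open>The last sum is the derivative of the observable \<open>power_sum N q\<close> along the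
  flow. The weight itself is never differentiated, so its integrability suffices for either sign of
  \<open>\<beta>\<close>.\<close>

lemma weighted_loop_equation:
  assumes w: "integrable (cube_uniform N) (jacobi_weight N \<beta> \<alpha>1 \<alpha>2)"
  shows "(LINT x|cube_uniform N. jacobi_weight N \<beta> \<alpha>1 \<alpha>2 x *
     (((\<Sum>l<N. \<alpha>1 * (1 - x l ^ p) - \<alpha>2 * (\<Sum>s=1..p. x l ^ s) + (1 - (real p + 1) * x l ^ p)) +
          \<beta> * (\<Sum>k<N. \<Sum>j<k. pair_quotient p (x k) (x j))) * power_sum N q x +
      (\<Sum>l<N. x l ^ q * (real q * (1 - x l ^ p))))) = 0"
proof -
  let ?w = "jacobi_weight N \<beta> \<alpha>1 \<alpha>2" and ?S = "open_unit_cube N"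
  let ?R1 = "\<lambda>x. (\<Sum>l<N. \<alpha>1 * (1 - x l ^ p) - \<alpha>2 * (\<Sum>s=1..p. x l ^ s) + (1 - (real p + 1) * x l ^ p)) +
          \<beta> * (\<Sum>k<N. \<Sum>j<k. pair_quotient p (x k) (x j))"
  let ?P = "\<lambda>t x. \<Sum>l<N. x l ^ q * (1 + t * (1 - x l ^ p)) ^ q"
  have coord: "(\<lambda>x. x l) \<in> borel_measurable (PiM {..<N} (\<lambda>_. borel :: real measure))" if "l < N" for l
    using that by simp
  have "first_order_on ?S (\<lambda>t x. x l ^ q * (1 + t * (1 - x l ^ p)) ^ q) (\<lambda>x. x l ^ q)
    (\<lambda>x. x l ^ q * (real q * (1 - x l ^ p)))" if l: "l < N" for l
  proof -
    have "first_order_on ?S (\<lambda>t x. (1 + t * (1 - x l ^ p)) ^ q) (\<lambda>_. 1) (\<lambda>x. real q * (1 - x l ^ p))"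
      using l by (intro first_order_on_power first_order_on_linear[of _ _ 1] abs_one_minus_power_le)
    moreover have "first_order_on ?S (\<lambda>t x. x l ^ q) (\<lambda>x. x l ^ q) (\<lambda>_. 0)"
      using open_unit_cubeD[OF _ l] by (intro first_order_on_const[of _ _ 1]) (simp add: power_le_one)
    ultimately show ?thesis using first_order_on_mult by fastforce
  qed
  then have P: "first_order_on ?S ?P (power_sum N q) (\<lambda>x. \<Sum>l<N. x l ^ q * (real q * (1 - x l ^ p)))"
    unfolding power_sum_def by (intro first_order_on_sum) auto
  have fo: "first_order_on ?S (\<lambda>t x. weight_ratio N \<beta> \<alpha>1 \<alpha>2 p t x * ?P t x) (power_sum N q)
    (\<lambda>x. ?R1 x * power_sum N q x + (\<Sum>l<N. x l ^ q * (real q * (1 - x l ^ p))))"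
    using first_order_on_mult[OF first_order_weight_ratio P] by simp
  have pq: "(\<lambda>x. pair_quotient p (x k) (x j)) \<in> borel_measurable (PiM {..<N} (\<lambda>_. borel :: real measure))"
    if "k < N" "j < N" for k j
    unfolding pair_quotient_def using coord[OF that(1)] coord[OF that(2)] by measurable
  have R: "weight_ratio N \<beta> \<alpha>1 \<alpha>2 p t \<in> borel_measurable (PiM {..<N} (\<lambda>_. borel :: real measure))" for t
    unfolding weight_ratio_def
    by (intro borel_measurable_times borel_measurable_prod powr_real_measurable borel_measurable_add
        borel_measurable_diff borel_measurable_uminus borel_measurable_const borel_measurable_sum borel_measurable_power coord pq) auto
  have R1: "?R1 \<in> borel_measurable (PiM {..<N} (\<lambda>_. borel :: real measure))"
    by (intro borel_measurable_times borel_measurable_add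
        borel_measurable_diff borel_measurable_const borel_measurable_sum borel_measurable_power coord pq) auto
  have Pm: "?P t \<in> borel_measurable (PiM {..<N} (\<lambda>_. borel :: real measure))" for t
    by (intro borel_measurable_times borel_measurable_add
        borel_measurable_diff borel_measurable_const borel_measurable_sum borel_measurable_power coord) auto
  have P1m: "(\<lambda>x. \<Sum>l<N. x l ^ q * (real q * (1 - x l ^ p))) \<in> borel_measurable (PiM {..<N} (\<lambda>_. borel :: real measure))"
    by (intro borel_measurable_times borel_measurable_add
        borel_measurable_diff borel_measurable_const borel_measurable_sum borel_measurable_power coord) auto
  show ?thesis
  proof (rule first_order_integral_zero[OF w _ AE_cube_uniform fo])
    show "0 < 1 / (real p + 1)" by simp
    fix t :: real assume t: "0 < t" "t < 1 / (real p + 1)"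
    let ?\<phi> = "loop_flow p t" and ?\<phi>' = "\<lambda>y. 1 + t * (1 - (real p + 1) * y ^ p)"
    have \<phi>: "(?\<phi> has_real_derivative ?\<phi>' y) (at y)" for y
      unfolding loop_flow_def
      by (rule DERIV_cong, rule DERIV_add[OF DERIV_ident DERIV_cmult[OF DERIV_diff[OF DERIV_ident DERIV_pow]]])
        (simp add: add.commute[of 1 "real p"])
    have "(LINT x|cube_uniform N. ?w x * power_sum N q x)
      = (LINT x|cube_uniform N. (\<Prod>l<N. ?\<phi>' (x l)) * (?w (compose {..<N} ?\<phi> x) * power_sum N q (compose {..<N} ?\<phi> x)))"
    proof (rule integral_cube_uniform_substitution[OF \<phi>])
      show "continuous_on UNIV ?\<phi>'" by (intro continuous_intros)
      show "?\<phi> 0 = 0" "?\<phi> 1 = 1" by (auto simp: loop_flow_def)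
      show "?\<phi> y \<in> {0<..<1}" if "y \<in> {0<..<1}" for y using loop_flow_in_unit[OF t that] .
      fix y :: real assume "y \<in> {0..1}"
      then have "y ^ p \<le> 1" by (auto intro: power_le_one)
      then have "(real p + 1) * y ^ p \<le> (real p + 1) * 1" by (intro mult_left_mono) auto
      moreover have "- b \<le> 1 - c" if "c \<le> (b + 1) * 1" for b c :: real using that by simp
      ultimately have "- real p \<le> 1 - (real p + 1) * y ^ p" by blast
      then show "0 \<le> ?\<phi>' y" by (rule less_imp_le[OF one_plus_pos[OF t]])
    qed measurable
    also have "\<dots> = (LINT x|cube_uniform N. ?w x * (weight_ratio N \<beta> \<alpha>1 \<alpha>2 p t x * ?P t x))"
    proof (rule Bochner_Integration.integral_cong_AE)
      have m': "compose {..<N} ?\<phi> \<in> measurable (PiM {..<N} (\<lambda>_. borel)) (PiM {..<N} (\<lambda>_. borel))"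
        unfolding compose_def loop_flow_def by measurable
      have "(\<lambda>x. \<Prod>l<N. ?\<phi>' (x l)) \<in> borel_measurable (PiM {..<N} (\<lambda>_. borel :: real measure))"
        by (intro borel_measurable_prod borel_measurable_times borel_measurable_add
            borel_measurable_diff borel_measurable_const borel_measurable_power coord) auto
      then show "(\<lambda>x. (\<Prod>l<N. ?\<phi>' (x l)) * (?w (compose {..<N} ?\<phi> x) * power_sum N q (compose {..<N} ?\<phi> x)))
          \<in> borel_measurable (cube_uniform N)"
        unfolding measurable_cube_uniform using measurable_compose[OF m' measurable_jacobi_weight]
          measurable_compose[OF m' power_sum_measurable] by (intro borel_measurable_times)
      show "(\<lambda>x. ?w x * (weight_ratio N \<beta> \<alpha>1 \<alpha>2 p t x * ?P t x)) \<in> borel_measurable (cube_uniform N)"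
        unfolding measurable_cube_uniform by (intro borel_measurable_times R Pm measurable_jacobi_weight)
      show "AE x in cube_uniform N. (\<Prod>l<N. ?\<phi>' (x l)) * (?w (compose {..<N} ?\<phi> x) * power_sum N q (compose {..<N} ?\<phi> x))
        = ?w x * (weight_ratio N \<beta> \<alpha>1 \<alpha>2 p t x * ?P t x)"
        using AE_cube_uniform
      proof eventually_elim
        case (elim x)
        have "power_sum N q (compose {..<N} ?\<phi> x) = ?P t x"
          unfolding power_sum_def by (intro sum.cong) (auto simp: compose_def loop_flow_factor power_mult_distrib)
        then show ?case
          using jacobi_weight_flow[OF t elim, of \<beta> \<alpha>1 \<alpha>2] by (simp add: mult.assoc[symmetric])
      qed
    qed
    finally show "(LINT x|cube_uniform N. ?w x * (weight_ratio N \<beta> \<alpha>1 \<alpha>2 p t x * ?P t x))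
      = (LINT x|cube_uniform N. ?w x * power_sum N q x)" ..
  next
    show "?w x \<ge> 0" for x by (rule jacobi_weight_nonneg)
    show "(\<lambda>x. weight_ratio N \<beta> \<alpha>1 \<alpha>2 p t x * ?P t x) \<in> borel_measurable (cube_uniform N)" for t
      unfolding measurable_cube_uniform by (rule borel_measurable_times[OF R Pm])
    show "power_sum N q \<in> borel_measurable (cube_uniform N)"
      unfolding measurable_cube_uniform by (rule power_sum_measurable)
    show "(\<lambda>x. ?R1 x * power_sum N q x + (\<Sum>l<N. x l ^ q * (real q * (1 - x l ^ p)))) \<in> borel_measurable (cube_uniform N)"
      unfolding measurable_cube_uniform
      by (rule borel_measurable_add[OF borel_measurable_times[OF R1 power_sum_measurable] P1m])
  qed
qed

text \<open>The sum over pairs is half of the full double sum minus its diagonal. The double sum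
  factorises into products of power sums, and the diagonal supplies the correction -
  \<open>\<beta>\<close> / 2 in the coefficient of \<open>power_sum N p\<close>, which later
  produces the term \<alpha> (p + 1) \<open>m0 p\<close>.\<close>

lemma weight_derivative_power_sums:
  "(\<Sum>l<N. \<alpha>1 * (1 - x l ^ p) - \<alpha>2 * (\<Sum>s=1..p. x l ^ s) + (1 - (real p + 1) * x l ^ p)) +
     \<beta> * (\<Sum>k<N. \<Sum>j<k. pair_quotient p (x k) (x j)) =
   (1 + \<alpha>1) * real N + \<beta> / 2 * (real N * (real N - 1))
     - (\<alpha>1 + (real p + 1) * (1 - \<beta> / 2)) * power_sum N p x
     - \<alpha>2 * (\<Sum>s=1..p. power_sum N s x)
     - \<beta> / 2 * (\<Sum>a\<le>p. power_sum N a x * power_sum N (p - a) x)"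
proof -
  have "(\<Sum>k<N. \<Sum>j<N. pair_quotient p (x k) (x j))
    = real N * real N - (\<Sum>k<N. \<Sum>j<N. \<Sum>a\<le>p. x k ^ a * x j ^ (p - a))"
    by (simp add: pair_quotient_def sum_subtractf)
  also have "(\<Sum>k<N. \<Sum>j<N. \<Sum>a\<le>p. x k ^ a * x j ^ (p - a))
     = (\<Sum>a\<le>p. \<Sum>k<N. \<Sum>j<N. x k ^ a * x j ^ (p - a))"
    by (subst sum.swap[of _ "{..<N}" "{..p}"], subst (2) sum.swap) (rule refl)
  also have "\<dots> = (\<Sum>a\<le>p. power_sum N a x * power_sum N (p - a) x)"
    by (simp add: power_sum_def sum_product)
  finally have full: "(\<Sum>k<N. \<Sum>j<N. pair_quotient p (x k) (x j))
     = real N * real N - (\<Sum>a\<le>p. power_sum N a x * power_sum N (p - a) x)" .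
  have diag: "(\<Sum>k<N. pair_quotient p (x k) (x k)) = real N - (real p + 1) * power_sum N p x"
    by (simp add: pair_quotient_def sum_subtractf power_sum_def sum_distrib_left add.commute[of 1 "real p"] flip: power_add)
  have half: "2 * (\<Sum>k<N. \<Sum>j<k. pair_quotient p (x k) (x j)) =
    real N * real N - (\<Sum>a\<le>p. power_sum N a x * power_sum N (p - a) x) - (real N - (real p + 1) * power_sum N p x)"
    using sum_symmetric_pairs[of "\<lambda>k j. pair_quotient p (x k) (x j)" N] full diag pair_quotient_sym[of p] by simp
  have "(\<Sum>l<N. \<alpha>1 * (1 - x l ^ p) - \<alpha>2 * (\<Sum>s=1..p. x l ^ s) + (1 - (real p + 1) * x l ^ p))
    = \<alpha>1 * (real N - power_sum N p x) - \<alpha>2 * (\<Sum>s=1..p. power_sum N s x) + (real N - (real p + 1) * power_sum N p x)"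
    unfolding power_sum_def sum.swap[of "\<lambda>s l. x l ^ s" "{..<N}" "{1..p}"]
    by (simp add: sum.distrib sum_subtractf right_diff_distrib flip: sum_distrib_left)
  moreover have "\<beta> * (\<Sum>k<N. \<Sum>j<k. pair_quotient p (x k) (x j)) = \<beta> / 2 *
    (real N * real N - (\<Sum>a\<le>p. power_sum N a x * power_sum N (p - a) x) - (real N - (real p + 1) * power_sum N p x))"
    unfolding half[symmetric] by simp
  ultimately show ?thesis by (simp only:) (simp add: field_simps)
qed

section \<open>Joint cumulants of low order\<close>

text \<open>A partition is determined by the block containing a, which is a together with some B,
  and a partition of what is left. Iteration enumerates the partitions of up to three
  points.\<close>

lemma partitions_insert:
  assumes "a \<notin> A"
  shows "{P. partition_on (insert a A) P} = (\<Union>B\<in>Pow A. insert (insert a B) ` {P. partition_on (A - B) P})"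
proof (intro equalityI subsetI)
  fix P assume "P \<in> {P. partition_on (insert a A) P}"
  then have P: "partition_on (insert a A) P" by simp
  then obtain p where p: "p \<in> P" "a \<in> p" by (auto simp: partition_on_def)
  define B where "B = p - {a}"
  have pB: "p = insert a B" using p by (auto simp: B_def)
  have BA: "B \<subseteq> A" using P p by (auto simp: partition_on_def B_def)
  have "disjnt p (\<Union>(P - {p}))"
    using P p by (auto simp: partition_on_def disjoint_def disjnt_def)
  moreover have PP: "insert p (P - {p}) = P" using p by auto
  ultimately have "partition_on (insert a A - p) (P - {p})"
    using partition_on_insert[of p "P - {p}" "insert a A"] P by simp
  moreover have "insert a A - p = A - B" using assms pB BA by auto
  ultimately show "P \<in> (\<Union>B\<in>Pow A. insert (insert a B) ` {P. partition_on (A - B) P})"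
    using PP BA pB by (intro UN_I[of B] image_eqI[of _ _ "P - {p}"]) auto
next
  fix P assume "P \<in> (\<Union>B\<in>Pow A. insert (insert a B) ` {P. partition_on (A - B) P})"
  then obtain B P' where B: "B \<subseteq> A" and P': "partition_on (A - B) P'" and P: "P = insert (insert a B) P'" by auto
  have "\<Union>P' = A - B" using P' by (auto simp: partition_on_def)
  then have "disjnt (insert a B) (\<Union>P')" using assms by (auto simp: disjnt_def)
  moreover have "insert a A - insert a B = A - B" using assms B by auto
  ultimately show "P \<in> {P. partition_on (insert a A) P}"
    using partition_on_insert[of "insert a B" P' "insert a A"] P' P B by auto
qed

lemma partitions_0: "{P. partition_on {} P} = {{}}"
  by (auto simp: partition_on_empty)

lemma partitions_1: "{P. partition_on {a} P} = {{{a}}}"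
  using partitions_insert[of a "{}"] by (simp add: partitions_0)

lemma partitions_2:
  assumes "a \<noteq> b" shows "{P. partition_on {a, b} P} = {{{a}, {b}}, {{a, b}}}"
  using partitions_insert[of a "{b}"] assms
  by (auto simp: partitions_0 partitions_1 Pow_insert)

lemma partitions_3:
  assumes "a \<noteq> b" "a \<noteq> c" "b \<noteq> c"
  shows "{P. partition_on {a, b, c} P} =
    {{{a}, {b}, {c}}, {{a}, {b, c}}, {{b}, {a, c}}, {{c}, {a, b}}, {{a, b, c}}}"
proof -
  have 1: "Pow {b, c} = {{}, {b}, {c}, {b, c}}" by (auto simp: Pow_insert)
  have 2: "{b, c} - {b} = {c}" "{b, c} - {c} = {b}" using assms by auto
  have "{P. partition_on {a, b, c} P} =
    insert {a} ` {P. partition_on {b, c} P} \<union> insert {a, b} ` {P. partition_on {c} P}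
    \<union> insert {a, c} ` {P. partition_on {b} P} \<union> insert {a, b, c} ` {P. partition_on {} P}"
    using partitions_insert[of a "{b, c}"] assms unfolding 1 by (simp add: 2 Un_assoc)
  also have "\<dots> = {{{a}, {b}, {c}}, {{a}, {b, c}}, {{b}, {a, c}}, {{c}, {a, b}}, {{a, b, c}}}"
    unfolding partitions_0 partitions_1 partitions_2[OF assms(3)]
    by (auto simp: insert_commute)
  finally show ?thesis .
qed

lemma joint_cumulant_1:
  fixes X :: "nat \<Rightarrow> 'a \<Rightarrow> real"
  shows "joint_cumulant M {..<1} X = (LINT \<omega>|M. X 0 \<omega>)"
proof -
  have 0: "{..<1::nat} = {0}" by auto
  show ?thesis unfolding joint_cumulant_def 0 partitions_1 by simp
qed

lemma joint_cumulant_2: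
  fixes X :: "nat \<Rightarrow> 'a \<Rightarrow> real"
  shows "joint_cumulant M {..<2} X = covariance M (X 0) (X 1)"
proof -
  have 0: "{..<2::nat} = {0, 1}" by auto
  have ne: "(0::nat) \<noteq> 1" by simp
  have d: "{{0}, {1}} \<noteq> {{0, 1::nat}}" by auto
  have e: "{0} \<noteq> {1::nat}" by auto
  show ?thesis
    unfolding joint_cumulant_def 0 partitions_2[OF ne] covariance_def using d e by simp
qed

lemma joint_cumulant_3:
  fixes X :: "nat \<Rightarrow> 'a \<Rightarrow> real"
  shows "joint_cumulant M {..<3} X =
     (LINT \<omega>|M. X 0 \<omega> * (X 1 \<omega> * X 2 \<omega>)) - (LINT \<omega>|M. X 0 \<omega>) * (LINT \<omega>|M. X 1 \<omega> * X 2 \<omega>)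
     - (LINT \<omega>|M. X 1 \<omega>) * (LINT \<omega>|M. X 0 \<omega> * X 2 \<omega>) - (LINT \<omega>|M. X 2 \<omega>) * (LINT \<omega>|M. X 0 \<omega> * X 1 \<omega>)
     + 2 * (LINT \<omega>|M. X 0 \<omega>) * (LINT \<omega>|M. X 1 \<omega>) * (LINT \<omega>|M. X 2 \<omega>)"
proof -
  have 0: "{..<3::nat} = {0, 1, 2}" by auto
  have ne: "(0::nat) \<noteq> 1" "(0::nat) \<noteq> 2" "(1::nat) \<noteq> 2" by simp_all
  \<comment> \<open>With names for the five partitions, the sum splits by the ten inequalities
    below, and the cardinalities give the coefficients 2, -1, -1, -1, 1.\<close>
  define p1 p2 p3 p4 p5 :: "nat set set" where p: "p1 = {{0}, {1}, {2}}" "p2 = {{0}, {1, 2}}" "p3 = {{1}, {0, 2}}"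
    "p4 = {{2}, {0, 1}}" "p5 = {{0, 1, 2}}"
  have b: "{0} \<noteq> {1::nat}" "{0} \<noteq> {2::nat}" "{1} \<noteq> {2::nat}" "{0} \<noteq> {1, 2::nat}" "{1} \<noteq> {0, 2::nat}"
     "{2} \<noteq> {0, 1::nat}" by auto
  have d: "p1 \<noteq> p2" "p1 \<noteq> p3" "p1 \<noteq> p4" "p1 \<noteq> p5" "p2 \<noteq> p3" "p2 \<noteq> p4" "p2 \<noteq> p5" "p3 \<noteq> p4" "p3 \<noteq> p5" "p4 \<noteq> p5"
    unfolding p by (auto simp: insert_eq_iff doubleton_eq_iff)
  have c: "card p1 = 3" "card p2 = 2" "card p3 = 2" "card p4 = 2" "card p5 = 1"
    unfolding p using b by simp_all
  have P: "{P. partition_on {0, 1, 2::nat} P} = {p1, p2, p3, p4, p5}"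
    unfolding p by (rule partitions_3[OF ne])
  let ?h = "\<lambda>B::nat set. LINT \<omega>|M. (\<Prod>i\<in>B. X i \<omega>)"
  have h: "prod ?h p1 = ?h {0} * ?h {1} * ?h {2}" "prod ?h p2 = ?h {0} * ?h {1,2}"
     "prod ?h p3 = ?h {1} * ?h {0,2}" "prod ?h p4 = ?h {2} * ?h {0,1}" "prod ?h p5 = ?h {0,1,2}"
    unfolding p using b by (simp_all add: mult.assoc)
  show ?thesis
    unfolding joint_cumulant_def 0 P using d
    by (simp add: c h fact_numeral)
qed

section \<open>Loop equations for moments and covariances\<close>

text \<open>Facts at fixed N depend on the parameters alone; the ansatz joins in
  \<open>high_temperature_jacobi\<close>. The bound by a minimum is split into the three
  inequalities taken by \<open>integrable_jacobi_weight\<close>.\<close>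

locale high_temperature_parameters =
  fixes \<alpha> \<alpha>1 \<alpha>2 :: real
  assumes \<alpha>1: "\<alpha>1 > -1" and \<alpha>2: "\<alpha>2 > -1"
    and \<alpha>: "\<alpha> > -1" "\<alpha> > - (1 + \<alpha>1)" "\<alpha> > - (1 + \<alpha>2)"
begin

abbreviation expect :: "nat \<Rightarrow> ((nat \<Rightarrow> real) \<Rightarrow> real) \<Rightarrow> real" where
  "expect N g \<equiv> (LINT x|high_temp_jacobi \<alpha> \<alpha>1 \<alpha>2 N. g x)"

abbreviation weight :: "nat \<Rightarrow> (nat \<Rightarrow> real) \<Rightarrow> real" where
  "weight N \<equiv> jacobi_weight N (2 * \<alpha> / real N) \<alpha>1 \<alpha>2"

abbreviation norm_const :: "nat \<Rightarrow> real" where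
  "norm_const N \<equiv> jacobi_norm N (2 * \<alpha> / real N) \<alpha>1 \<alpha>2"

lemma integrable_weight: "N > 0 \<Longrightarrow> integrable (cube_uniform N) (weight N)"
  by (rule integrable_jacobi_weight[OF \<alpha>1 \<alpha>2 \<alpha>])

lemma norm_const_pos: "N > 0 \<Longrightarrow> norm_const N > 0"
  by (rule jacobi_norm_pos[OF integrable_weight])

lemma expect_eq:
  assumes "N > 0" "g \<in> borel_measurable (PiM {..<N} (\<lambda>_. borel))"
  shows "expect N g = (LINT x|cube_uniform N. weight N x * g x) / norm_const N"
proof -
  have "g \<in> borel_measurable (cube_uniform N)" "(\<lambda>x. weight N x / norm_const N) \<in> borel_measurable (cube_uniform N)"
    using assms by (auto simp: measurable_cube_uniform)
  then have "expect N g = (LINT x|cube_uniform N. weight N x / norm_const N * g x)"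
    unfolding jacobi_ensemble_eq using norm_const_pos[OF assms(1)]
    by (subst integral_density) (auto intro!: AE_I2 divide_nonneg_pos)
  also have "\<dots> = (LINT x|cube_uniform N. (weight N x * g x) / norm_const N)" by simp
  also have "\<dots> = (LINT x|cube_uniform N. weight N x * g x) / norm_const N"
    by (rule integral_divide_zero)
  finally show ?thesis .
qed

lemma prob_space_ensemble: "N > 0 \<Longrightarrow> prob_space (high_temp_jacobi \<alpha> \<alpha>1 \<alpha>2 N)"
proof (rule prob_spaceI)
  assume N: "N > 0"
  have m: "(\<lambda>x. ennreal (weight N x / norm_const N)) \<in> borel_measurable (cube_uniform N)"
    by (auto simp: measurable_cube_uniform)
  have "emeasure (high_temp_jacobi \<alpha> \<alpha>1 \<alpha>2 N) (space (high_temp_jacobi \<alpha> \<alpha>1 \<alpha>2 N))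
    = (\<integral>\<^sup>+x. ennreal (weight N x / norm_const N) \<partial>cube_uniform N)"
    unfolding jacobi_ensemble_eq using m by (subst emeasure_density) (auto intro!: nn_integral_cong)
  also have "\<dots> = ennreal (LINT x|cube_uniform N. weight N x / norm_const N)"
    using integrable_weight[OF N] norm_const_pos[OF N]
    by (intro nn_integral_eq_integral) (auto intro!: AE_I2 divide_nonneg_pos)
  also have "\<dots> = 1"
    using norm_const_pos[OF N] by (simp add: jacobi_norm_eq)
  finally show "emeasure (high_temp_jacobi \<alpha> \<alpha>1 \<alpha>2 N) (space (high_temp_jacobi \<alpha> \<alpha>1 \<alpha>2 N)) = 1" .
qed

lemma integrable_ensemble:
  fixes g :: "(nat \<Rightarrow> real) \<Rightarrow> real"
  assumes N: "N > 0" and g: "g \<in> borel_measurable (PiM {..<N} (\<lambda>_. borel))"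
    and B: "\<And>x. x \<in> open_unit_cube N \<Longrightarrow> \<bar>g x\<bar> \<le> B"
  shows "integrable (high_temp_jacobi \<alpha> \<alpha>1 \<alpha>2 N) g"
proof -
  have m: "g \<in> borel_measurable (cube_uniform N)" "(\<lambda>x. weight N x / norm_const N) \<in> borel_measurable (cube_uniform N)"
    using g by (auto simp: measurable_cube_uniform)
  have "integrable (cube_uniform N) (\<lambda>x. weight N x / norm_const N * g x)"
  proof (rule Bochner_Integration.integrable_bound)
    show "integrable (cube_uniform N) (\<lambda>x. B * (weight N x / norm_const N))"
      using integrable_weight[OF N] by simp
    show "AE x in cube_uniform N. norm (weight N x / norm_const N * g x) \<le> norm (B * (weight N x / norm_const N))"
      using AE_cube_uniform
    proof eventually_elim
      case (elim x)
      have "\<bar>weight N x / norm_const N\<bar> * \<bar>g x\<bar> \<le> \<bar>weight N x / norm_const N\<bar> * \<bar>B\<bar>"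
        using B[OF elim] by (intro mult_left_mono) auto
      then show ?case by (simp only: real_norm_def abs_mult mult.commute)
    qed
  qed (use m in measurable)
  then show ?thesis
    unfolding jacobi_ensemble_eq using m norm_const_pos[OF N]
    by (subst integrable_density) (auto intro!: AE_I2 divide_nonneg_pos)
qed

definition mean :: "nat \<Rightarrow> nat \<Rightarrow> real" where
  "mean N p = expect N (power_sum N p)"

definition mom2 :: "nat \<Rightarrow> nat \<Rightarrow> nat \<Rightarrow> real" where
  "mom2 N p q = expect N (\<lambda>x. power_sum N p x * power_sum N q x)"

definition mom3 :: "nat \<Rightarrow> nat \<Rightarrow> nat \<Rightarrow> nat \<Rightarrow> real" where
  "mom3 N a b q = expect N (\<lambda>x. power_sum N a x * (power_sum N b x * power_sum N q x))"

lemma mom2_commute: "mom2 N p q = mom2 N q p"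
  unfolding mom2_def by (simp add: mult.commute)

lemma power_sum_0: "power_sum N 0 x = real N"
  by (simp add: power_sum_def)

lemma mean_0: "N > 0 \<Longrightarrow> mean N 0 = real N"
  using prob_space.prob_space[OF prob_space_ensemble] by (simp add: mean_def power_sum_0)

lemma mom2_0: "mom2 N p 0 = real N * mean N p"
  by (simp add: mom2_def power_sum_0 mean_def)

lemma mom3_0: "mom3 N a b 0 = real N * mom2 N a b"
  by (simp add: mom2_def power_sum_0 mom3_def mult.assoc[symmetric])

lemma integrable_power_sums:
  assumes N: "N > 0"
  shows "integrable (high_temp_jacobi \<alpha> \<alpha>1 \<alpha>2 N) (power_sum N p)"
    and "integrable (high_temp_jacobi \<alpha> \<alpha>1 \<alpha>2 N) (\<lambda>x. power_sum N p x * power_sum N q x)"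
    and "integrable (high_temp_jacobi \<alpha> \<alpha>1 \<alpha>2 N) (\<lambda>x. power_sum N a x * (power_sum N p x * power_sum N q x))"
proof -
  note b = power_sum_bounds
  show "integrable (high_temp_jacobi \<alpha> \<alpha>1 \<alpha>2 N) (power_sum N p)"
    by (rule integrable_ensemble[OF N _ b]) measurable
  show "integrable (high_temp_jacobi \<alpha> \<alpha>1 \<alpha>2 N) (\<lambda>x. power_sum N p x * power_sum N q x)"
    by (rule integrable_ensemble[OF N, of _ "real N * real N"]) (auto simp: abs_mult intro!: mult_mono b)
  show "integrable (high_temp_jacobi \<alpha> \<alpha>1 \<alpha>2 N) (\<lambda>x. power_sum N a x * (power_sum N p x * power_sum N q x))"
    by (rule integrable_ensemble[OF N, of _ "real N * (real N * real N)"])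
      (auto simp: abs_mult intro!: mult_mono b)
qed

text \<open>Exact for every N > 0, but not closed: the equation for q = 0 involves second moments,
  and for general q it involves third moments.\<close>

lemma loop_equation:
  assumes N: "N > 0"
  shows "((1 + \<alpha>1) * real N + \<alpha> * (real N - 1)) * mean N q
     - (\<alpha>1 + (real p + 1) * (1 - \<alpha> / real N)) * mom2 N p q
     - \<alpha>2 * (\<Sum>s=1..p. mom2 N s q) - \<alpha> / real N * (\<Sum>a\<le>p. mom3 N a (p - a) q)
     + real q * (mean N q - mean N (q + p)) = 0"
proof -
  let ?b = "2 * \<alpha> / real N"
  let ?g = "\<lambda>x. ((1 + \<alpha>1) * real N + \<alpha> * (real N - 1)) * power_sum N q x
     - (\<alpha>1 + (real p + 1) * (1 - \<alpha> / real N)) * (power_sum N p x * power_sum N q x)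
     - \<alpha>2 * (\<Sum>s=1..p. power_sum N s x * power_sum N q x)
     - \<alpha> / real N * (\<Sum>a\<le>p. power_sum N a x * (power_sum N (p - a) x * power_sum N q x))
     + real q * (power_sum N q x - power_sum N (q + p) x)"
  have "(\<Sum>l<N. x l ^ q * (real q * (1 - x l ^ p))) = real q * (power_sum N q x - power_sum N (q + p) x)" for x
    by (simp add: power_sum_def sum_distrib_left sum_subtractf right_diff_distrib power_add mult_ac)
  then have eq: "((\<Sum>l<N. \<alpha>1 * (1 - x l ^ p) - \<alpha>2 * (\<Sum>s=1..p. x l ^ s) + (1 - (real p + 1) * x l ^ p)) +
          ?b * (\<Sum>k<N. \<Sum>j<k. pair_quotient p (x k) (x j))) * power_sum N q x +
      (\<Sum>l<N. x l ^ q * (real q * (1 - x l ^ p))) = ?g x" for x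
  proof -
    have "?b / 2 * (real N * (real N - 1)) = \<alpha> * (real N - 1)" "?b / 2 = \<alpha> / real N" using N by simp_all
    then show ?thesis
      unfolding \<open>(\<Sum>l<N. x l ^ q * (real q * (1 - x l ^ p))) = _\<close> weight_derivative_power_sums
      by (simp only: left_diff_distrib mult.assoc sum_distrib_right)
  qed
  have "expect N ?g = 0"
    using weighted_loop_equation[OF integrable_weight[OF N], of p q] unfolding eq
    by (subst expect_eq[OF N]) auto
  moreover have "expect N ?g = ((1 + \<alpha>1) * real N + \<alpha> * (real N - 1)) * mean N q
     - (\<alpha>1 + (real p + 1) * (1 - \<alpha> / real N)) * mom2 N p q
     - \<alpha>2 * (\<Sum>s=1..p. mom2 N s q) - \<alpha> / real N * (\<Sum>a\<le>p. mom3 N a (p - a) q)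
     + real q * (mean N q - mean N (q + p))"
    unfolding mean_def mom2_def mom3_def using integrable_power_sums[OF N] by simp
  ultimately show ?thesis by simp
qed

definition nmean :: "nat \<Rightarrow> nat \<Rightarrow> real" where
  "nmean p N = mean N p / real N"

definition ncov :: "nat \<Rightarrow> nat \<Rightarrow> nat \<Rightarrow> real" where
  "ncov p q N = (mom2 N p q - mean N p * mean N q) / real N"

text \<open>The divisor is the power of N with which the third cumulant enters the covariance
  equation. It exceeds the order of the cumulant by one, so this quantity tends to 0.\<close>

definition ncum3 :: "nat \<Rightarrow> nat \<Rightarrow> nat \<Rightarrow> nat \<Rightarrow> real" where
  "ncum3 a b q N = (mom3 N a b q - mean N a * mom2 N b q - mean N b * mom2 N a q - mean N q * mom2 N a b
      + 2 * mean N a * mean N b * mean N q) / (real N)\<^sup>2"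

text \<open>The case q = 0 divided by N^2. Splitting second moments into products of means and
  covariances places the covariances at relative order 1 / N; they therefore affect
  \<open>m1\<close> and not the equation for \<open>m0\<close>.\<close>

lemma loop_equation_mean:
  assumes N: "N > 0"
  shows "(1 + \<alpha>1) + \<alpha> * (1 - 1 / real N) - (\<alpha>1 + (real p + 1) * (1 - \<alpha> / real N)) * nmean p N
     - \<alpha>2 * (\<Sum>s=1..p. nmean s N)
     - \<alpha> * (\<Sum>a\<le>p. nmean a N * nmean (p - a) N + ncov a (p - a) N / real N) = 0"
proof -
  have "(\<Sum>a\<le>p. nmean a N * nmean (p - a) N + ncov a (p - a) N / real N) = (\<Sum>a\<le>p. mom2 N a (p - a)) / (real N)\<^sup>2"
    unfolding sum_divide_distrib nmean_def ncov_def
    by (intro sum.cong refl) (simp add: power2_eq_square diff_divide_distrib)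
  then have "(1 + \<alpha>1) + \<alpha> * (1 - 1 / real N) - (\<alpha>1 + (real p + 1) * (1 - \<alpha> / real N)) * nmean p N
     - \<alpha>2 * (\<Sum>s=1..p. nmean s N)
     - \<alpha> * (\<Sum>a\<le>p. nmean a N * nmean (p - a) N + ncov a (p - a) N / real N)
     = (((1 + \<alpha>1) * real N + \<alpha> * (real N - 1)) * mean N 0
     - (\<alpha>1 + (real p + 1) * (1 - \<alpha> / real N)) * mom2 N p 0
     - \<alpha>2 * (\<Sum>s=1..p. mom2 N s 0) - \<alpha> / real N * (\<Sum>a\<le>p. mom3 N a (p - a) 0)
     + real 0 * (mean N 0 - mean N (0 + p))) / (real N)\<^sup>2"
    using N unfolding mean_0[OF N] mom2_0 mom3_0 nmean_def sum_distrib_left[symmetric] sum_divide_distrib[symmetric]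
    by (simp add: field_simps power2_eq_square)
  then show ?thesis unfolding loop_equation[OF N] by simp
qed

text \<open>Subtracting the mean of one power sum times the previous equation leaves only covariances and
  third cumulants.\<close>

lemma loop_equation_cov:
  assumes N: "N > 0"
  shows "(\<alpha>1 + (real p + 1) * (1 - \<alpha> / real N)) * ncov p q N + \<alpha>2 * (\<Sum>s=1..p. ncov s q N)
     + \<alpha> * (\<Sum>a\<le>p. ncum3 a (p - a) q N + nmean a N * ncov (p - a) q N + nmean (p - a) N * ncov a q N)
     = real q * (nmean q N - nmean (q + p) N)"
proof -
  let ?K = "(1 + \<alpha>1) * real N + \<alpha> * (real N - 1)" and ?c = "\<alpha>1 + (real p + 1) * (1 - \<alpha> / real N)"
  \<comment> \<open>The equation for q = 0 carries a common factor N, the value of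
    \<open>power_sum N 0\<close>, which is cancelled here.\<close>
  have L0: "?K - ?c * mean N p - \<alpha>2 * (\<Sum>s=1..p. mean N s) - \<alpha> / real N * (\<Sum>a\<le>p. mom2 N a (p - a)) = 0"
  proof -
    have "real N * (?K - ?c * mean N p - \<alpha>2 * (\<Sum>s=1..p. mean N s) - \<alpha> / real N * (\<Sum>a\<le>p. mom2 N a (p - a))) = 0"
      using loop_equation[OF N, of 0 p] unfolding mean_0[OF N] mom2_0 mom3_0 sum_distrib_left[symmetric]
      by (simp add: algebra_simps)
    then show ?thesis using N by simp
  qed
  have A: "(\<Sum>s=1..p. ncov s q N) = ((\<Sum>s=1..p. mom2 N s q) - (\<Sum>s=1..p. mean N s) * mean N q) / real N"
    by (simp add: ncov_def sum_divide_distrib[symmetric] sum_subtractf sum_distrib_right)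
  \<comment> \<open>The identity behind each summand: a third moment minus the disconnected part
    E[ab] E[q] is the third cumulant plus E[a] cov(b,q) plus E[b] cov(a,q).\<close>
  have B: "(\<Sum>a\<le>p. ncum3 a (p - a) q N + nmean a N * ncov (p - a) q N + nmean (p - a) N * ncov a q N)
     = ((\<Sum>a\<le>p. mom3 N a (p - a) q) - (\<Sum>a\<le>p. mom2 N a (p - a)) * mean N q) / (real N)\<^sup>2"
    unfolding sum_distrib_right sum_subtractf[symmetric] sum_divide_distrib nmean_def ncov_def ncum3_def
    by (intro sum.cong refl) (simp add: power2_eq_square add_divide_distrib[symmetric], simp add: algebra_simps)
  have C: "ncov p q N = (mom2 N p q - mean N p * mean N q) / real N"
    "nmean q N - nmean (q + p) N = (mean N q - mean N (q + p)) / real N"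
    by (simp_all add: ncov_def nmean_def diff_divide_distrib)
  have "?c * ncov p q N + \<alpha>2 * (\<Sum>s=1..p. ncov s q N)
     + \<alpha> * (\<Sum>a\<le>p. ncum3 a (p - a) q N + nmean a N * ncov (p - a) q N + nmean (p - a) N * ncov a q N)
     - real q * (nmean q N - nmean (q + p) N) =
    (mean N q * (?K - ?c * mean N p - \<alpha>2 * (\<Sum>s=1..p. mean N s) - \<alpha> / real N * (\<Sum>a\<le>p. mom2 N a (p - a)))
     - (?K * mean N q - ?c * mom2 N p q - \<alpha>2 * (\<Sum>s=1..p. mom2 N s q) - \<alpha> / real N * (\<Sum>a\<le>p. mom3 N a (p - a) q)
       + real q * (mean N q - mean N (q + p)))) / real N"
    unfolding A B C using N
    by (simp add: power2_eq_square add_divide_distrib diff_divide_distrib algebra_simps)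
  also have "\<dots> = 0" unfolding L0 loop_equation[OF N] by simp
  finally show ?thesis by simp
qed

end

section \<open>Large-N limits\<close>

text \<open>Two limits determine both coefficients. They give uniqueness and can be combined term by
  term in the loop equations.\<close>

lemma two_term_expansion_limits:
  assumes "two_term_expansion f a b"
  shows "f \<longlonglongrightarrow> a" "(\<lambda>N. real N * (f N - a)) \<longlonglongrightarrow> b"
proof -
  obtain C where C: "eventually (\<lambda>N. norm (f N - (a + 1 / real N * b)) \<le> C * norm (1 / real N ^ 2)) sequentially"
    using assms unfolding two_term_expansion_def by (elim landau_o.bigE)
  have "eventually (\<lambda>N. norm (real N * (f N - a) - b) \<le> C * (1 / real N)) sequentially"
    using C eventually_gt_at_top[of 0]
  proof eventually_elim
    case (elim N)
    have "real N * (f N - a) - b = real N * (f N - (a + 1 / real N * b))"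
      using elim by (simp add: field_simps)
    also have "norm \<dots> = real N * norm (f N - (a + 1 / real N * b))" by (simp add: abs_mult)
    also have "\<dots> \<le> real N * (C * norm (1 / real N ^ 2))"
      by (rule mult_left_mono[OF elim(1)]) simp
    also have "\<dots> = C * (1 / real N)" using elim by (simp add: power2_eq_square)
    finally show ?case .
  qed
  moreover have "(\<lambda>N. C * (1 / real N)) \<longlonglongrightarrow> 0"
    using tendsto_mult_right_zero[OF lim_1_over_n] by simp
  ultimately have "(\<lambda>N. real N * (f N - a) - b) \<longlonglongrightarrow> 0"
    by (rule Lim_null_comparison)
  then show lim: "(\<lambda>N. real N * (f N - a)) \<longlonglongrightarrow> b" by (simp add: LIM_zero_iff)
  have "(\<lambda>N. 1 / real N * (real N * (f N - a))) \<longlonglongrightarrow> 0 * b"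
    by (intro tendsto_mult lim_1_over_n lim)
  then have "(\<lambda>N. f N - a) \<longlonglongrightarrow> 0 * b"
    by (rule Lim_transform_eventually) (rule eventually_mono[OF eventually_gt_at_top[of 0]], simp)
  then show "f \<longlonglongrightarrow> a" by (simp add: LIM_zero_iff)
qed

lemma two_term_expansion_unique:
  assumes "two_term_expansion f a b" "two_term_expansion f a' b'"
  shows "a = a'" "b = b'"
proof -
  note l = two_term_expansion_limits[OF assms(1)] two_term_expansion_limits[OF assms(2)]
  show a: "a = a'" using LIMSEQ_unique[OF l(1) l(3)] .
  show "b = b'" using LIMSEQ_unique[OF l(2)] l(4) unfolding a .
qed

lemma has_large_N_expansion_leading:
  assumes "has_large_N_expansion f c"
  shows "(\<lambda>N. f N / real N) \<longlonglongrightarrow> c 0"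
proof -
  have "(\<lambda>N. f N - real N * c 0) \<in> O(\<lambda>N. real N * (1 / real N))"
    using assms unfolding has_large_N_expansion_def by (drule_tac spec[of _ 0]) simp
  then obtain C where C: "eventually (\<lambda>N. norm (f N - real N * c 0) \<le> C * norm (real N * (1 / real N))) sequentially"
    by (elim landau_o.bigE)
  have "eventually (\<lambda>N. norm (f N / real N - c 0) \<le> C * (1 / real N)) sequentially"
    using C eventually_gt_at_top[of 0]
  proof eventually_elim
    case (elim N)
    have "f N / real N - c 0 = (f N - real N * c 0) / real N" using elim by (simp add: field_simps)
    also have "norm \<dots> \<le> C / real N" using elim by (simp add: divide_right_mono)
    finally show ?case by simp
  qed
  moreover have "(\<lambda>N. C * (1 / real N)) \<longlonglongrightarrow> 0"
    using tendsto_mult_right_zero[OF lim_1_over_n] by simp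
  ultimately have "(\<lambda>N. f N / real N - c 0) \<longlonglongrightarrow> 0" by (rule Lim_null_comparison)
  then show ?thesis by (simp add: LIM_zero_iff)
qed

lemma has_large_N_expansion_two_term:
  assumes "has_large_N_expansion f c"
  shows "two_term_expansion (\<lambda>N. 1 / real N * f N) (c 0) (c 1)"
proof -
  have "(\<lambda>N. f N - real N * (\<Sum>l\<le>1. c l / real N ^ l)) \<in> O(\<lambda>N. real N * (1 / real N ^ Suc 1))"
    using assms unfolding has_large_N_expansion_def by blast
  then have "(\<lambda>N. 1 / real N * (f N - real N * (\<Sum>l\<le>1. c l / real N ^ l)))
      \<in> O(\<lambda>N. 1 / real N * (real N * (1 / real N ^ Suc 1)))"
    by (intro landau_o.big.mult_left)
  also have "(\<lambda>N. 1 / real N * (real N * (1 / real N ^ Suc 1))) \<in> O(\<lambda>N. 1 / real N ^ 2)"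
    by (intro bigoI[of _ 1] eventually_mono[OF eventually_gt_at_top[of 0]]) (simp add: power2_eq_square)
  finally have mem: "(\<lambda>N. 1 / real N * (f N - real N * (\<Sum>l\<le>1. c l / real N ^ l))) \<in> O(\<lambda>N. 1 / real N ^ 2)" .
  have eq: "eventually (\<lambda>N. 1 / real N * (f N - real N * (\<Sum>l\<le>1. c l / real N ^ l))
      = 1 / real N * f N - (c 0 + 1 / real N * c 1)) sequentially"
    using eventually_gt_at_top[of 0] by eventually_elim (simp add: field_simps)
  show ?thesis
    unfolding two_term_expansion_def by (rule iffD1[OF landau_o.big.in_cong[OF eq] mem])
qed

section \<open>Index bookkeeping for sums over p + q = n\<close>

lemma sum_atMost_split:
  fixes g :: "nat \<Rightarrow> 'a::comm_monoid_add"
  assumes "p \<ge> 1"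
  shows "(\<Sum>a\<le>p. g a) = g 0 + (\<Sum>a=1..p-1. g a) + g p"
proof -
  have "{..p} = insert 0 (insert p {1..p-1})" using assms by auto
  then show ?thesis using assms by (simp add: add_ac)
qed

lemma sum_Icc_split_last:
  fixes g :: "nat \<Rightarrow> 'a::comm_monoid_add"
  assumes "p \<ge> 1"
  shows "(\<Sum>a=1..p. g a) = (\<Sum>a=1..p-1. g a) + g p"
  using assms by (cases p) auto

lemma sum_atMost_flip: "(\<Sum>a\<le>p. g a (p - a)) = (\<Sum>a\<le>p::nat. g (p - a) a)"
  by (intro sum.reindex_bij_witness[of _ "\<lambda>a. p - a" "\<lambda>a. p - a"]) auto

lemma sum_atMost_drop_0:
  fixes g :: "nat \<Rightarrow> 'a::comm_monoid_add"
  assumes "g 0 = 0"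
  shows "(\<Sum>a\<le>n. g a) = (\<Sum>a=1..n. g a)"
proof -
  have "{..n} = insert 0 {1..n}" by auto
  then show ?thesis using assms by simp
qed

text \<open>The indices of \<open>\<mu>\<close> add up to s = n - p + a, and the argument p - a of
  \<open>W\<close> is n - s. Collecting equal s assembles complete sums over a + b = s; the absent
  terms a = 0 vanish by assumption.\<close>

lemma sum_triangle_regroup:
  fixes \<mu> :: "nat \<Rightarrow> nat \<Rightarrow> real"
  assumes "\<And>q. \<mu> 0 q = 0"
  shows "(\<Sum>p=1..n. \<Sum>a=1..p-1. W (p - a) * \<mu> a (n - p)) = (\<Sum>s=1..n-1. W (n - s) * (\<Sum>a\<le>s. \<mu> a (s - a)))"
proof -
  have "(\<Sum>p=1..n. \<Sum>a=1..p-1. W (p - a) * \<mu> a (n - p)) = (\<Sum>s=1..n-1. \<Sum>a=1..s. W (n - s) * \<mu> a (s - a))"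
    unfolding sum.Sigma[OF finite_atLeastAtMost ballI[OF finite_atLeastAtMost]]
    by (intro sum.reindex_bij_witness[of _ "\<lambda>(s, a). (n - s + a, a)" "\<lambda>(p, a). (n - p + a, a)"]) auto
  also have "\<dots> = (\<Sum>s=1..n-1. W (n - s) * (\<Sum>a\<le>s. \<mu> a (s - a)))"
    using assms by (simp add: sum_distrib_left sum_atMost_drop_0)
  finally show ?thesis .
qed

text \<open>The recursion for pairs is summed over p = 1..n with q = n - p; the omitted p = 0
  belongs to the vanishing \<open>\<mu> 0 n\<close>.\<close>

lemma summed_covariance_recursion:
  fixes \<mu> :: "nat \<Rightarrow> nat \<Rightarrow> real" and m :: "nat \<Rightarrow> real"
  assumes \<mu>0: "\<And>q. \<mu> 0 q = 0" and sym: "\<And>p q. \<mu> p q = \<mu> q p"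
    and rec: "\<And>p q. p \<ge> 1 \<Longrightarrow> (real p + A) * \<mu> p q + b * (\<Sum>a=1..p-1. m (p - a) * \<mu> a q) + c * (\<Sum>a=1..p-1. \<mu> a q)
      = real q * (m q - m (q + p))"
    and n: "n \<ge> 1"
  defines "\<mu>t \<equiv> \<lambda>s. \<Sum>a\<le>s. \<mu> a (s - a)"
  shows "(real n / 2 + A) * \<mu>t n + b * (\<Sum>s=1..n-1. m (n - s) * \<mu>t s) + c * (\<Sum>s=1..n-1. \<mu>t s)
    = (\<Sum>s=1..n-1. real s * m s) - (real n - 1) * real n / 2 * m n"
proof -
  have drop0: "(\<Sum>p\<le>n. g p * \<mu> p (n - p)) = (\<Sum>p=1..n. g p * \<mu> p (n - p))" for g :: "nat \<Rightarrow> real"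
    using \<mu>0 by (intro sum_atMost_drop_0) simp
  \<comment> \<open>By symmetry of \<open>\<mu>\<close> the factor p may be exchanged for n - p;
    adding both versions gives n, hence the n / 2.\<close>
  have "(\<Sum>p\<le>n. real p * \<mu> p (n - p)) = (\<Sum>p\<le>n. real (n - p) * \<mu> p (n - p))"
    using sum_atMost_flip[of "\<lambda>a d. real a * \<mu> a d" n] sym by simp
  then have "2 * (\<Sum>p\<le>n. real p * \<mu> p (n - p)) = (\<Sum>p\<le>n. real p * \<mu> p (n - p) + real (n - p) * \<mu> p (n - p))"
    unfolding sum.distrib by simp
  also have "\<dots> = real n * \<mu>t n"
    unfolding \<mu>t_def sum_distrib_left by (intro sum.cong) (auto simp: of_nat_diff algebra_simps)
  finally have half: "(\<Sum>p=1..n. real p * \<mu> p (n - p)) = real n / 2 * \<mu>t n"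
    unfolding drop0 by simp
  have "(\<Sum>p=1..n. (real p + A) * \<mu> p (n - p)) = (real n / 2 + A) * \<mu>t n"
    using half drop0[of "\<lambda>_. 1"] unfolding \<mu>t_def distrib_right sum.distrib
    by (simp add: sum_distrib_left[symmetric])
  moreover have "(\<Sum>p=1..n. \<Sum>a=1..p-1. m (p - a) * \<mu> a (n - p)) = (\<Sum>s=1..n-1. m (n - s) * \<mu>t s)"
    unfolding \<mu>t_def by (rule sum_triangle_regroup[where \<mu>=\<mu>, OF \<mu>0])
  moreover have "(\<Sum>p=1..n. \<Sum>a=1..p-1. \<mu> a (n - p)) = (\<Sum>s=1..n-1. \<mu>t s)"
    unfolding \<mu>t_def using sum_triangle_regroup[where \<mu>=\<mu>, OF \<mu>0, where W="\<lambda>_. 1"] by simp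
  ultimately have "(real n / 2 + A) * \<mu>t n + b * (\<Sum>s=1..n-1. m (n - s) * \<mu>t s) + c * (\<Sum>s=1..n-1. \<mu>t s)
    = (\<Sum>p=1..n. (real p + A) * \<mu> p (n - p) + b * (\<Sum>a=1..p-1. m (p - a) * \<mu> a (n - p)) + c * (\<Sum>a=1..p-1. \<mu> a (n - p)))"
    by (simp only: sum.distrib sum_distrib_left[symmetric])
  also have "\<dots> = (\<Sum>p=1..n. real (n - p) * (m (n - p) - m n))"
    using rec by (intro sum.cong) auto
  also have "\<dots> = (\<Sum>s<n. real s * (m s - m n))"
    by (intro sum.reindex_bij_witness[of _ "\<lambda>s. n - s" "\<lambda>s. n - s"]) auto
  also have "\<dots> = (\<Sum>s<n. real s * m s) - (\<Sum>s<n. real s) * m n"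
    by (simp add: right_diff_distrib sum_subtractf sum_distrib_right)
  also have "(\<Sum>s<n. real s) = (real n - 1) * real n / 2"
    by (induction n) (auto simp: field_simps)
  also have "(\<Sum>s<n. real s * m s) = (\<Sum>s=1..n-1. real s * m s)"
  proof -
    have "{..<n} = insert 0 {1..n-1}" using n by auto
    then show ?thesis by simp
  qed
  finally show ?thesis .
qed

lemma tilde_sum_eq: "(\<Sum>(a, b) | a + b = p. f a b) = (\<Sum>a\<le>p. f a (p - a))" for p :: nat
  by (intro sum.reindex_bij_witness[of _ "\<lambda>a. (a, p - a)" fst]) auto

section \<open>Coefficients supplied by the ansatz and passage to the limit\<close>

locale high_temperature_jacobi = high_temperature_parameters +
  assumes ansatz: "large_N_ansatz \<alpha> \<alpha>1 \<alpha>2"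
begin

abbreviation "m0 \<equiv> jacobi_m0 \<alpha> \<alpha>1 \<alpha>2"
abbreviation "m1 \<equiv> jacobi_m1 \<alpha> \<alpha>1 \<alpha>2"
abbreviation "mu \<equiv> jacobi_mu0 \<alpha> \<alpha>1 \<alpha>2"

lemma jacobi_moment_eq: "jacobi_moment \<alpha> \<alpha>1 \<alpha>2 p = nmean p"
  by (simp add: fun_eq_iff jacobi_moment_def nmean_def mean_def)

lemma cumulant_expansion:
  fixes p :: "nat \<Rightarrow> nat"
  shows "n \<ge> 1 \<Longrightarrow> \<exists>c. has_large_N_expansion
     (\<lambda>N. joint_cumulant (high_temp_jacobi \<alpha> \<alpha>1 \<alpha>2 N) {..<n} (\<lambda>i. power_sum N (p i))) c"
  using ansatz unfolding large_N_ansatz_def by blast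

text \<open>The first cumulant is the mean, so the ansatz for n = 1 gives existence. Uniqueness then
  lets the two separate definite descriptions pick the coefficients of the same expansion.\<close>

lemma nmean_expansion: "two_term_expansion (nmean p) (m0 p) (m1 p)"
proof -
  have "\<exists>c. has_large_N_expansion
     (\<lambda>N. joint_cumulant (high_temp_jacobi \<alpha> \<alpha>1 \<alpha>2 N) {..<1::nat} (\<lambda>i. power_sum N p)) c"
    by (rule cumulant_expansion[of 1 "\<lambda>_. p"]) simp
  then obtain c where c: "has_large_N_expansion
     (\<lambda>N. joint_cumulant (high_temp_jacobi \<alpha> \<alpha>1 \<alpha>2 N) {..<1::nat} (\<lambda>i. power_sum N p)) c" ..
  then have *: "two_term_expansion (nmean p) (c 0) (c 1)"
    using has_large_N_expansion_two_term[OF c] unfolding joint_cumulant_1 nmean_def[abs_def] mean_def by simp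
  then have "m0 p = c 0" "m1 p = c 1"
    unfolding jacobi_m0_def jacobi_m1_def jacobi_moment_eq
    by (auto intro!: the_equality dest: two_term_expansion_unique)
  with * show ?thesis by simp
qed

lemma tendsto_nmean: "nmean p \<longlonglongrightarrow> m0 p"
  and tendsto_nmean_correction: "(\<lambda>N. real N * (nmean p N - m0 p)) \<longlonglongrightarrow> m1 p"
  using two_term_expansion_limits[OF nmean_expansion] by auto

lemma moments_0: "m0 0 = 1" "m1 0 = 0"
proof -
  \<comment> \<open>At N = 0 the division by zero yields 0 instead of 1, so the equality is stated
    for N > 0.\<close>
  have "eventually (\<lambda>N. nmean 0 N = 1) sequentially"
    using eventually_gt_at_top[of 0] by eventually_elim (simp add: nmean_def mean_0)
  then have "(\<lambda>N. nmean 0 N - (1 + 1 / real N * 0)) \<in> O(\<lambda>N. 1 / real N ^ 2)"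
    by (intro bigoI[of _ 1]) (auto elim!: eventually_mono)
  then have "two_term_expansion (nmean 0) 1 0" by (simp add: two_term_expansion_def)
  from two_term_expansion_unique[OF nmean_expansion this] show "m0 0 = 1" "m1 0 = 0" by auto
qed

lemma covariance_eq:
  "covariance (high_temp_jacobi \<alpha> \<alpha>1 \<alpha>2 N) (power_sum N p) (power_sum N q) = mom2 N p q - mean N p * mean N q"
  by (simp add: covariance_def mom2_def mean_def)

lemma tendsto_ncov: "ncov p q \<longlonglongrightarrow> mu p q"
proof -
  have "\<exists>c. has_large_N_expansion
     (\<lambda>N. joint_cumulant (high_temp_jacobi \<alpha> \<alpha>1 \<alpha>2 N) {..<2::nat} (\<lambda>i. power_sum N ((\<lambda>i. if i = 0 then p else q) i))) c"
    by (rule cumulant_expansion[of 2 "\<lambda>i. if i = 0 then p else q"]) simp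
  then obtain c where c: "has_large_N_expansion
     (\<lambda>N. joint_cumulant (high_temp_jacobi \<alpha> \<alpha>1 \<alpha>2 N) {..<2::nat} (\<lambda>i. power_sum N ((\<lambda>i. if i = 0 then p else q) i))) c" ..
  then have *: "ncov p q \<longlonglongrightarrow> c 0"
    using has_large_N_expansion_leading[OF c] unfolding joint_cumulant_2 ncov_def[abs_def] by (simp add: covariance_eq)
  then have "mu p q = c 0"
    unfolding jacobi_mu0_def covariance_eq ncov_def[abs_def] by (intro limI) simp
  with * show ?thesis by simp
qed

lemma tendsto_ncum3: "ncum3 a b q \<longlonglongrightarrow> 0"
proof -
  let ?p = "\<lambda>i::nat. if i = 0 then a else if i = 1 then b else q"
  have "\<exists>c. has_large_N_expansion
     (\<lambda>N. joint_cumulant (high_temp_jacobi \<alpha> \<alpha>1 \<alpha>2 N) {..<3::nat} (\<lambda>i. power_sum N (?p i))) c"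
    by (rule cumulant_expansion[of 3 ?p]) simp
  then obtain c where c: "has_large_N_expansion
     (\<lambda>N. joint_cumulant (high_temp_jacobi \<alpha> \<alpha>1 \<alpha>2 N) {..<3::nat} (\<lambda>i. power_sum N (?p i))) c" ..
  from tendsto_mult[OF lim_1_over_n has_large_N_expansion_leading[OF c]]
  show ?thesis
    unfolding joint_cumulant_3 ncum3_def[abs_def] mom3_def mom2_def mean_def
    by (simp add: power2_eq_square)
qed

lemma mu_sym: "mu p q = mu q p"
proof -
  have "ncov p q = ncov q p" by (simp add: fun_eq_iff ncov_def mom2_commute mult.commute)
  then show ?thesis using tendsto_ncov[of p q] tendsto_ncov[of q p] LIMSEQ_unique by metis
qed

text \<open>\<open>power_sum N 0\<close> is the constant N, and a constant has no
  covariance.\<close>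

lemma mu_0: "mu 0 q = 0"
proof -
  have "eventually (\<lambda>N. 0 = ncov 0 q N) sequentially"
    using eventually_gt_at_top[of 0]
    by eventually_elim (simp add: ncov_def mean_0 mom2_commute[of _ 0] mom2_0)
  then have "ncov 0 q \<longlonglongrightarrow> 0" by (rule Lim_transform_eventually[OF tendsto_const])
  then show ?thesis using tendsto_ncov LIMSEQ_unique by blast
qed

text \<open>Reflecting a to p - a shows that the two mixed sums agree, hence the factor 2 \<alpha>.
  The term a = p, where \<open>m0 0\<close> is 1, and the term s = p join the coefficient of
  \<open>mu p q\<close>; the term a = 0 vanishes with \<open>mu 0 q\<close>.\<close>

lemma mu_recursion:
  assumes "p \<ge> 1"
  shows "(real p + (\<alpha>1 + \<alpha>2 + 2 * \<alpha> + 1)) * mu p q + 2 * \<alpha> * (\<Sum>a=1..p-1. m0 (p - a) * mu a q)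
     + \<alpha>2 * (\<Sum>a=1..p-1. mu a q) = real q * (m0 q - m0 (q + p))"
proof -
  let ?L = "\<lambda>N. (\<alpha>1 + (real p + 1) * (1 - \<alpha> * (1 / real N))) * ncov p q N + \<alpha>2 * (\<Sum>s=1..p. ncov s q N)
     + \<alpha> * (\<Sum>a\<le>p. ncum3 a (p - a) q N + nmean a N * ncov (p - a) q N + nmean (p - a) N * ncov a q N)
     - real q * (nmean q N - nmean (q + p) N)"
  \<comment> \<open>The limits 0 of 1 / N and of the third cumulants are left unsimplified, so that
    this expression mirrors \<open>?L\<close> and the limit follows structurally.\<close>
  let ?l = "(\<alpha>1 + (real p + 1) * (1 - \<alpha> * 0)) * mu p q + \<alpha>2 * (\<Sum>s=1..p. mu s q)
     + \<alpha> * (\<Sum>a\<le>p. 0 + m0 a * mu (p - a) q + m0 (p - a) * mu a q)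
     - real q * (m0 q - m0 (q + p))"
  have "?L \<longlonglongrightarrow> ?l"
    by (intro tendsto_intros tendsto_nmean tendsto_ncov tendsto_ncum3 lim_1_over_n)
  moreover have "?L \<longlonglongrightarrow> 0"
  proof (rule Lim_transform_eventually[OF tendsto_const])
    show "eventually (\<lambda>N. 0 = ?L N) sequentially"
      using eventually_gt_at_top[of 0] by eventually_elim (use loop_equation_cov[of _ p q] in simp)
  qed
  ultimately have "?l = 0" by (rule LIMSEQ_unique)
  moreover have "(\<Sum>a\<le>p. 0 + m0 a * mu (p - a) q + m0 (p - a) * mu a q) = 2 * (\<Sum>a\<le>p. m0 (p - a) * mu a q)"
    using sum_atMost_flip[of "\<lambda>a d. m0 a * mu d q" p] by (simp add: sum.distrib)
  moreover have "(\<Sum>a\<le>p. m0 (p - a) * mu a q) = (\<Sum>a=1..p-1. m0 (p - a) * mu a q) + mu p q"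
    using sum_atMost_split[OF assms, of "\<lambda>a. m0 (p - a) * mu a q"] by (simp add: mu_0 moments_0)
  ultimately show ?thesis
    using sum_Icc_split_last[OF assms, of "\<lambda>s. mu s q"] by (simp add: algebra_simps)
qed

text \<open>The mean equation holds exactly at each N > 0 and its limit is an equation for
  \<open>m0\<close>. N times their difference converges, and its limit is the equation for
  \<open>m1\<close>.\<close>

lemma m1_recursion:
  assumes "p \<ge> 1"
  shows "(real p + 1 + \<alpha>1 + \<alpha>2 + 2 * \<alpha>) * m1 p =
     \<alpha> * (real p + 1) * m0 p - \<alpha> * ((\<Sum>a\<le>p. mu a (p - a)) + 1)
          - 2 * \<alpha> * (\<Sum>s=1..p-1. m1 s * m0 (p - s)) - \<alpha>2 * (\<Sum>s=1..p-1. m1 s)"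
proof -
  let ?E = "\<lambda>N. (1 + \<alpha>1) + \<alpha> * (1 - 1 / real N) - (\<alpha>1 + (real p + 1) * (1 - \<alpha> * (1 / real N))) * nmean p N
     - \<alpha>2 * (\<Sum>s=1..p. nmean s N)
     - \<alpha> * (\<Sum>a\<le>p. nmean a N * nmean (p - a) N + ncov a (p - a) N * (1 / real N))"
  let ?e = "(1 + \<alpha>1) + \<alpha> * (1 - 0) - (\<alpha>1 + (real p + 1) * (1 - \<alpha> * 0)) * m0 p
     - \<alpha>2 * (\<Sum>s=1..p. m0 s) - \<alpha> * (\<Sum>a\<le>p. m0 a * m0 (p - a) + mu a (p - a) * 0)"
  have E0: "?E N = 0" if "N > 0" for N
    using loop_equation_mean[OF that, of p] by simp
  have "?E \<longlonglongrightarrow> ?e"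
    by (intro tendsto_intros tendsto_nmean tendsto_ncov lim_1_over_n)
  moreover have "?E \<longlonglongrightarrow> 0"
  proof (rule Lim_transform_eventually[OF tendsto_const])
    show "eventually (\<lambda>N. 0 = ?E N) sequentially"
      using eventually_gt_at_top[of 0] by eventually_elim (simp only: E0)
  qed
  ultimately have e: "?e = 0" by (rule LIMSEQ_unique)
  \<comment> \<open>Differences of products are split as f g - f0 g0 = (f - f0) g + f0 (g - g0), so
    each summand of \<open>?D\<close> has a limit. The constant -\<alpha> and the term with \<alpha>
    (p + 1) come from the explicit 1 / N in \<open>?E\<close>.\<close>
  let ?r = "\<lambda>p N. real N * (nmean p N - m0 p)"
  let ?D = "\<lambda>N. - \<alpha> - (\<alpha>1 + real p + 1) * ?r p N + \<alpha> * (real p + 1) * nmean p N - \<alpha>2 * (\<Sum>s=1..p. ?r s N)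
    - \<alpha> * (\<Sum>a\<le>p. ?r a N * nmean (p - a) N + m0 a * ?r (p - a) N + ncov a (p - a) N)"
  let ?d = "- \<alpha> - (\<alpha>1 + real p + 1) * m1 p + \<alpha> * (real p + 1) * m0 p - \<alpha>2 * (\<Sum>s=1..p. m1 s)
    - \<alpha> * (\<Sum>a\<le>p. m1 a * m0 (p - a) + m0 a * m1 (p - a) + mu a (p - a))"
  have "?D \<longlonglongrightarrow> ?d"
    by (intro tendsto_intros tendsto_nmean tendsto_nmean_correction tendsto_ncov)
  moreover have "?D N = 0" if N: "N > 0" for N
  proof -
    have 1: "(\<Sum>s=1..p. ?r s N) = real N * ((\<Sum>s=1..p. nmean s N) - (\<Sum>s=1..p. m0 s))"
      unfolding sum_subtractf[symmetric] sum_distrib_left ..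
    have 2: "(\<Sum>a\<le>p. ?r a N * nmean (p - a) N + m0 a * ?r (p - a) N + ncov a (p - a) N)
      = real N * ((\<Sum>a\<le>p. nmean a N * nmean (p - a) N + ncov a (p - a) N * (1 / real N))
                 - (\<Sum>a\<le>p. m0 a * m0 (p - a) + mu a (p - a) * 0))"
      unfolding sum_subtractf[symmetric] sum_distrib_left using N
      by (intro sum.cong refl) (simp add: algebra_simps)
    have "?D N = real N * (?E N - ?e)"
      unfolding 1 2 using N by (simp add: algebra_simps) (simp add: field_simps)
    then show ?thesis unfolding E0[OF N] e by simp
  qed
  then have "?D \<longlonglongrightarrow> 0"
    by (intro Lim_transform_eventually[OF tendsto_const] eventually_mono[OF eventually_gt_at_top[of 0]]) (simp only:)
  ultimately have "?d = 0" by (rule LIMSEQ_unique)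
  moreover have "(\<Sum>a\<le>p. m1 a * m0 (p - a) + m0 a * m1 (p - a) + mu a (p - a))
     = 2 * (\<Sum>a\<le>p. m1 a * m0 (p - a)) + (\<Sum>a\<le>p. mu a (p - a))"
    using sum_atMost_flip[of "\<lambda>a d. m1 a * m0 d" p] by (simp add: sum.distrib mult.commute)
  moreover have "(\<Sum>a\<le>p. m1 a * m0 (p - a)) = (\<Sum>a=1..p-1. m1 a * m0 (p - a)) + m1 p"
    using sum_atMost_split[OF assms, of "\<lambda>a. m1 a * m0 (p - a)"] by (simp add: moments_0)
  ultimately show ?thesis
    using sum_Icc_split_last[OF assms, of m1] by (simp add: algebra_simps)
qed

end

theorem mainTheorem9:
  fixes \<alpha> \<alpha>1 \<alpha>2 :: real
  defines "m0 \<equiv> jacobi_m0 \<alpha> \<alpha>1 \<alpha>2"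
    and "m1 \<equiv> jacobi_m1 \<alpha> \<alpha>1 \<alpha>2"
    and "\<mu>t \<equiv> jacobi_mu_tilde0 \<alpha> \<alpha>1 \<alpha>2"
  assumes "\<alpha>1 > -1" and "\<alpha>2 > -1"
    and "\<alpha> > - Min {1, 1 + \<alpha>1, 1 + \<alpha>2}"
    and "large_N_ansatz \<alpha> \<alpha>1 \<alpha>2"
  shows "m1 0 = 0 \<and>
    (\<forall>p\<ge>1.
      m1 p = 1 / (real p + 1 + \<alpha>1 + \<alpha>2 + 2 * \<alpha>) *
        (\<alpha> * (real p + 1) * m0 p - \<alpha> * (\<mu>t p + 1)
          - 2 * \<alpha> * (\<Sum>s=1..p-1. m1 s * m0 (p - s))
          - \<alpha>2 * (\<Sum>s=1..p-1. m1 s))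
      \<and>
      (\<alpha>1 + \<alpha>2 + 2 * \<alpha> + 1 + real p / 2) * \<mu>t p =
        (\<Sum>s=1..p-1. real s * m0 s) - (real p - 1) * real p / 2 * m0 p
          - \<alpha>2 * (\<Sum>s=1..p-1. \<mu>t s)
          - 2 * \<alpha> * (\<Sum>s=1..p-1. \<mu>t s * m0 (p - s)))"
proof -
  have "\<alpha> > -1" "\<alpha> > - (1 + \<alpha>1)" "\<alpha> > - (1 + \<alpha>2)"
    using assms(6) by (auto simp: min_def split: if_splits)
  then interpret J: high_temperature_jacobi \<alpha> \<alpha>1 \<alpha>2
    using assms(4,5,7) by unfold_locales auto
  have \<mu>t: "\<mu>t = (\<lambda>s. \<Sum>a\<le>s. jacobi_mu0 \<alpha> \<alpha>1 \<alpha>2 a (s - a))"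
    by (simp add: \<mu>t_def jacobi_mu_tilde0_def fun_eq_iff tilde_sum_eq)
  show ?thesis
  proof (intro conjI allI impI)
    show "m1 0 = 0" unfolding m1_def by (rule J.moments_0)
    fix p :: nat assume p: "1 \<le> p"
    \<comment> \<open>Adding the two bounds \<alpha> > -(1 + \<alpha>1) and \<alpha> > -(1 +
      \<alpha>2) gives 2 \<alpha> + \<alpha>1 + \<alpha>2 > -2, so the denominator is positive for p
      at least 1.\<close>
    have "real p + 1 + \<alpha>1 + \<alpha>2 + 2 * \<alpha> \<noteq> 0" using p J.\<alpha> by simp
    then show "m1 p = 1 / (real p + 1 + \<alpha>1 + \<alpha>2 + 2 * \<alpha>) *
        (\<alpha> * (real p + 1) * m0 p - \<alpha> * (\<mu>t p + 1)
          - 2 * \<alpha> * (\<Sum>s=1..p-1. m1 s * m0 (p - s))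
          - \<alpha>2 * (\<Sum>s=1..p-1. m1 s))"
      using J.m1_recursion[OF p] unfolding \<mu>t m0_def m1_def by (simp add: nonzero_eq_divide_eq mult.commute)
    \<comment> \<open>The same bounds place this coefficient only above p / 2 - 1; it can vanish for
      p = 1, and the equation stays in product form.\<close>
    show "(\<alpha>1 + \<alpha>2 + 2 * \<alpha> + 1 + real p / 2) * \<mu>t p =
        (\<Sum>s=1..p-1. real s * m0 s) - (real p - 1) * real p / 2 * m0 p
          - \<alpha>2 * (\<Sum>s=1..p-1. \<mu>t s)
          - 2 * \<alpha> * (\<Sum>s=1..p-1. \<mu>t s * m0 (p - s))"
      using summed_covariance_recursion[OF J.mu_0 J.mu_sym J.mu_recursion p]
      unfolding \<mu>t m0_def by (simp add: algebra_simps)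
  qed
qed

end
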